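(* Let $I$ be a nonzero squarefree monomial ideal of $R=\mathbb{K}[x_1,\dots,x_n]$, and let $k$ be an integer with $k>\min\{|\operatorname{supp}(u)| : u \text{ a monomial in } I\}$. Let $I_k$ be the squarefree truncation of $I$ past $k$, and let $f^k_{r-1}$ denote the number of faces of cardinality $r$ of the Stanley-Reisner complex $\Delta_{I_k}$. Then $$\beta_{i,i+j}(R/I_k)=\begin{cases}1 & \text{if } i=0,\ j=0,\\ 0 & \text{if } i\neq 0,\ 0\le j\le k-2,\\ \alpha_{i,i+k-1} & \text{if } i\ne 0,\ j=k-1,\\ \beta_{i,i+j}(R/I) & \text{if } i\neq 0,\ j\ge k,\end{cases}$$ where $$\alpha_{i,i+j}=\sum_{r=0}^{i+j}(-1)^{j-r}\binom{n-r}{i+j-r}f^k_{r-1}+\sum_{\substack{\ell+m=i+j\\ \ell<i}}(-1)^{\ell-i-1}\beta_{\ell,\ell+m}(R/I).$$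
   Context: $\mathbb{K}$ is a field and $R=\mathbb{K}[x_1,\dots,x_n]$ has the standard grading. For a finitely generated graded $R$-module $N$, $\beta_{i,j}(N)=\dim_{\mathbb K}\operatorname{Tor}^R_{i}(N,\mathbb{K})_j$ are the graded Betti numbers. For a monomial $u$, $\operatorname{supp}(u)$ is the set of variables dividing $u$. For an integer $k$, $M_k$ is the ideal generated by the squarefree monomials lying in $(x_1,\dots,x_n)^k$ (i.e. of degree $\ge k$), and for a squarefree monomial ideal $I$, $I_k=I\cap M_k$; equivalently $I_k$ is the ideal generated by all squarefree monomials of degree $\ge k$ in $I$. For a squarefree monomial ideal $L$, the Stanley-Reisner complex is $\Delta_L=\{\operatorname{supp}(u): u \text{ a squarefree monomial not in } L\}$, a simplicial complex on subsets of $\{x_1,\dots,x_n\}$. A face $F$ has dimension $|F|-1$. We put $f^k_{r-1}=0$ if $\Delta_{I_k}$ has no face of cardinality $r$. In the second sum, $\ell,m$ range over nonnegative integers. *)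

theory Defs
  imports Complex_Main "HOL-Library.Poly_Mapping" "HOL-Library.Function_Algebras" "HOL-Library.Cardinality"
begin

type_synonym ('n, 'k) mpoly = "('n \<Rightarrow>\<^sub>0 nat) \<Rightarrow>\<^sub>0 'k"
  \<comment> \<open>The variables are indexed by a finite type, so the number of variables is the
      cardinality of that type.\<close>

definition monomial :: "('n \<Rightarrow>\<^sub>0 nat) \<Rightarrow> ('n, 'k::field) mpoly" where
  "monomial m = Poly_Mapping.single m 1"

definition mdeg :: "('n::finite \<Rightarrow>\<^sub>0 nat) \<Rightarrow> nat" where
  "mdeg m = (\<Sum>x\<in>UNIV. Poly_Mapping.lookup m x)"

text \<open>The zero polynomial is homogeneous of every degree; degrees are integers because
  generators of graded free modules may have arbitrary integer degrees.\<close>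

definition homogeneous :: "int \<Rightarrow> ('n::finite, 'k::field) mpoly \<Rightarrow> bool" where
  "homogeneous d f \<longleftrightarrow> (\<forall>m\<in>Poly_Mapping.keys f. int (mdeg m) = d)"

definition squarefree_mon :: "('n \<Rightarrow>\<^sub>0 nat) \<Rightarrow> bool" where
  "squarefree_mon m \<longleftrightarrow> (\<forall>x. Poly_Mapping.lookup m x \<le> 1)"

text \<open>A commutative ring is a module over itself via multiplication; the span of a set is the
  ideal generated by it. The locale is not interpreted globally, since its simplification rules
  for the scalar multiplication would clash with the associative law.\<close>

lemma module_times: "module ((*) :: 'a::comm_ring_1 \<Rightarrow> 'a \<Rightarrow> 'a)"
  by unfold_locales (simp_all add: algebra_simps)

definition ideal_gen :: "'a::comm_ring_1 set \<Rightarrow> 'a set" where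
  "ideal_gen S = module.span (*) S"

definition squarefree_monomial_ideal :: "('n, 'k::field) mpoly set \<Rightarrow> bool" where
  "squarefree_monomial_ideal I \<longleftrightarrow>
     (\<exists>S \<subseteq> Collect squarefree_mon. I = ideal_gen (monomial ` S))"

definition sqfree_power :: "int \<Rightarrow> ('n::finite, 'k::field) mpoly set" where
  "sqfree_power k = ideal_gen (monomial ` {m. squarefree_mon m \<and> int (mdeg m) \<ge> k})"

definition sqfree_truncation ::
    "('n::finite, 'k::field) mpoly set \<Rightarrow> int \<Rightarrow> ('n, 'k) mpoly set" where
  "sqfree_truncation I k = I \<inter> sqfree_power k"

definition stanley_reisner :: "('n, 'k::field) mpoly set \<Rightarrow> 'n set set" where
  "stanley_reisner L = {Poly_Mapping.keys u |u. squarefree_mon u \<and> monomial u \<notin> L}"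

definition num_faces :: "'n set set \<Rightarrow> nat \<Rightarrow> nat" where
  "num_faces \<Delta> r = card {F \<in> \<Delta>. card F = r}"


section \<open>Graded free resolutions and graded Betti numbers of cyclic modules\<close>

text \<open>Elements of a free module of rank r are functions on the natural numbers vanishing
  from r on. The function \<open>mat_map q r A\<close> is the map from rank r to rank q given by the
  matrix A, acting on column vectors.\<close>

definition free_mod :: "nat \<Rightarrow> (nat \<Rightarrow> 'a::zero) set" where
  "free_mod r = {v. \<forall>s\<ge>r. v s = 0}"

definition mat_map ::
    "nat \<Rightarrow> nat \<Rightarrow> (nat \<Rightarrow> nat \<Rightarrow> 'a::comm_semiring_1) \<Rightarrow> (nat \<Rightarrow> 'a) \<Rightarrow> nat \<Rightarrow> 'a" where
  "mat_map q r A v = (\<lambda>t. if t < q then \<Sum>s<r. A t s * v s else 0)"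

text \<open>A resolution of R/I by finitely generated graded free modules. The list \<open>ds p\<close> contains
  the degrees of the basis elements of the p-th free module F(p), that is, F(p) is the direct
  sum of the shifts R(-d) over the entries d of \<open>ds p\<close>. The matrix \<open>D p\<close> is the differential
  from F(p+1) to F(p), and \<open>e s\<close> is a homogeneous representative in R of the image of the s-th
  basis element under the augmentation from F(0) to R/I. The conditions say: the maps are
  graded of degree 0, the augmentation is onto R/I, and the augmented complex is exact at F(0)
  and at F(p+1) for all p.\<close>

definition graded_free_resolution ::
    "('n::finite, 'k::field) mpoly set \<Rightarrow> (nat \<Rightarrow> int list) \<Rightarrow>
     (nat \<Rightarrow> nat \<Rightarrow> nat \<Rightarrow> ('n, 'k) mpoly) \<Rightarrow> (nat \<Rightarrow> ('n, 'k) mpoly) \<Rightarrow> bool" where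
  "graded_free_resolution I ds D e \<longleftrightarrow>
     (let rk = (\<lambda>p. length (ds p));
          \<delta> = (\<lambda>p. mat_map (rk p) (rk (Suc p)) (D p));
          \<epsilon> = (\<lambda>v. \<Sum>s<rk 0. e s * v s)
      in (\<forall>p. \<forall>t<rk p. \<forall>s<rk (Suc p). homogeneous (ds (Suc p) ! s - ds p ! t) (D p t s)) \<and>
         (\<forall>s<rk 0. homogeneous (ds 0 ! s) (e s)) \<and>
         (\<forall>f. \<exists>v\<in>free_mod (rk 0). f - \<epsilon> v \<in> I) \<and>
         {v \<in> free_mod (rk 0). \<epsilon> v \<in> I} = \<delta> 0 ` free_mod (rk 1) \<and>
         (\<forall>p. {v \<in> free_mod (rk (Suc p)). \<delta> p v = (\<lambda>_. 0)}
                = \<delta> (Suc p) ` free_mod (rk (Suc (Suc p)))))"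

definition fscale :: "'k::field \<Rightarrow> (nat \<Rightarrow> 'k) \<Rightarrow> nat \<Rightarrow> 'k" where
  "fscale c v = (\<lambda>s. c * v s)"

global_interpretation fun_vs: vector_space "fscale :: 'k::field \<Rightarrow> (nat \<Rightarrow> 'k) \<Rightarrow> nat \<Rightarrow> 'k"
  by unfold_locales (auto simp: fscale_def fun_eq_iff algebra_simps)

text \<open>Tensoring F(p) with K = R/(x1,...,xn) gives the vector space with the same basis, and the
  differentials become the matrices of constant coefficients. In internal degree j only the
  basis elements of degree j remain.\<close>

definition tor_chains :: "(nat \<Rightarrow> int list) \<Rightarrow> nat \<Rightarrow> int \<Rightarrow> (nat \<Rightarrow> 'k::field) set" where
  "tor_chains ds i j = {v \<in> free_mod (length (ds i)). \<forall>s<length (ds i). v s \<noteq> 0 \<longrightarrow> ds i ! s = j}"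

definition tor_diff ::
    "(nat \<Rightarrow> int list) \<Rightarrow> (nat \<Rightarrow> nat \<Rightarrow> nat \<Rightarrow> ('n, 'k::field) mpoly) \<Rightarrow> nat \<Rightarrow>
     (nat \<Rightarrow> 'k) \<Rightarrow> nat \<Rightarrow> 'k" where
  "tor_diff ds D p =
     mat_map (length (ds p)) (length (ds (Suc p))) (\<lambda>t s. Poly_Mapping.lookup (D p t s) 0)"

definition tor_cycles ::
    "(nat \<Rightarrow> int list) \<Rightarrow> (nat \<Rightarrow> nat \<Rightarrow> nat \<Rightarrow> ('n, 'k::field) mpoly) \<Rightarrow> nat \<Rightarrow> int \<Rightarrow>
     (nat \<Rightarrow> 'k) set" where
  "tor_cycles ds D i j =
     (case i of 0 \<Rightarrow> tor_chains ds 0 j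
      | Suc p \<Rightarrow> {v \<in> tor_chains ds (Suc p) j. tor_diff ds D p v = (\<lambda>_. 0)})"

definition tor_boundaries ::
    "(nat \<Rightarrow> int list) \<Rightarrow> (nat \<Rightarrow> nat \<Rightarrow> nat \<Rightarrow> ('n, 'k::field) mpoly) \<Rightarrow> nat \<Rightarrow> int \<Rightarrow>
     (nat \<Rightarrow> 'k) set" where
  "tor_boundaries ds D i j = tor_diff ds D i ` tor_chains ds (Suc i) j"

definition tor_dim ::
    "(nat \<Rightarrow> int list) \<Rightarrow> (nat \<Rightarrow> nat \<Rightarrow> nat \<Rightarrow> ('n, 'k::field) mpoly) \<Rightarrow> nat \<Rightarrow> int \<Rightarrow> nat" where
  "tor_dim ds D i j = fun_vs.dim (tor_cycles ds D i j) - fun_vs.dim (tor_boundaries ds D i j)"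

text \<open>The dimension over K of the degree j part of Tor(R/I, K) in homological degree i,
  computed from a chosen graded free resolution of R/I; it does not depend on the choice.\<close>

definition graded_betti :: "('n::finite, 'k::field) mpoly set \<Rightarrow> nat \<Rightarrow> int \<Rightarrow> nat" where
  "graded_betti I i j =
     (SOME b. \<exists>ds D e. graded_free_resolution I ds D e \<and> b = tor_dim ds D i j)"

text \<open>The value of \<open>alpha I k i j\<close> is the number written with indices i and i+j. Where r exceeds
  the number of variables the truncated subtraction is harmless, as there are no faces of that
  cardinality.\<close>

definition alpha :: "('n::finite, 'k::field) mpoly set \<Rightarrow> int \<Rightarrow> nat \<Rightarrow> nat \<Rightarrow> real" where
  "alpha I k i j =
     (\<Sum>r = 0..i + j. (-1) powi (int j - int r) * real ((CARD('n) - r) choose (i + j - r))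
        * real (num_faces (stanley_reisner (sqfree_truncation I k)) r))
     + (\<Sum>(l, m)\<in>{(l, m). l + m = i + j \<and> l < i}.
          (-1) powi (int l - int i - 1) * real (graded_betti I l (int (l + m))))"

end

theory Submission
  imports Defs "HOL-Analysis.Cartesian_Space" "HOL-Library.Countable"
begin

text \<open>A squarefree monomial ideal \<open>I\<close> consists of the polynomials all of whose monomials have
  support outside its Stanley-Reisner complex \<open>\<Delta>\<close>. The quotient \<open>R/I\<close> has an explicit, generally
  not minimal, finite free resolution: its basis in homological degree \<open>p\<close> consists of the pairs
  \<open>(F, G)\<close> of disjoint sets with \<open>G \<in> \<Delta>\<close> and \<open>|F| = p\<close>, and the differential sends \<open>(F, G)\<close> to the
  signed sum over \<open>a \<in> F\<close> of \<open>x\<^sub>a (F - a, G) - (F - a, G + a)\<close>, the second term being dropped if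
  \<open>G + a \<notin> \<Delta>\<close>. This is the squarefree part of the Koszul complex of \<open>x\<^sub>a \<otimes> 1 - 1 \<otimes> x\<^sub>a\<close> with
  coefficients in \<open>R \<otimes> R/I\<close>. By the comparison theorem the graded Betti numbers can be read off from
  it, and tensoring with \<open>K\<close> leaves only the terms \<open>(F - a, G + a)\<close>.

  The truncation replaces \<open>\<Delta>\<close> by its union with all sets of cardinality less than \<open>k\<close>. In the
  strand \<open>|G| \<ge> k\<close> this changes neither cycles nor boundaries, in the strand \<open>|G| \<le> k - 2\<close> the complex
  looks like that of a full simplex and is exact, and the remaining Betti number of each internal
  degree is determined by the Euler characteristic.\<close>

text \<open>\<open>graded_betti\<close> is a choice over all resolutions, so a value can be computed
  only once existence and independence are both settled. Minimal resolutions can have ranks that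
  depend on the characteristic; the complex used here has a basis described by \<Delta> alone. The
  price is that exactness over the polynomial ring must be proved directly. The fine grading does
  this: in a multidegree b each basis element occurs at most once, and the differential depends only
  on the support of b, which leaves a finite problem about sets.

  The formula for \<open>alpha\<close> is read off from the same basis. There are binom(n-r, d-r)
  f_(r-1) pairs (F, G) with |G| = r and |F| = d - r, so the first sum is, up to the sign (-1)^i, the
  Euler characteristic of the complex in internal degree d = i + k - 1. In this degree the Betti
  numbers with l > i have d - l \<le> k - 2 and vanish, those with l < i have d - l \<ge> k and
  agree with the ones of R/I, and solving for l = i gives the second sum.\<close>

section \<open>Independence of the resolution\<close>

text \<open>\<open>fZ\<close> and \<open>fB\<close> make \<open>f\<close> injective modulo
  \<open>B2\<close> on a complement of \<open>B1\<close> in \<open>Z1\<close>: when a basis of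
  \<open>B1\<close> is extended to \<open>Z1\<close>, the images of the added vectors are
  independent modulo \<open>B2\<close>. Differences of dimensions stand in for quotients, as in
  \<open>tor_dim\<close>. Two vector spaces are allowed because chains occur both as functions on
  numbers and as finite vectors.\<close>

lemma (in vector_space_pair) dim_quotient_le:
  assumes lf: "Vector_Spaces.linear s1 s2 f"
    and Z1: "vs1.subspace Z1" "Z1 \<subseteq> vs1.span W1" "finite W1"
    and Z2: "vs2.subspace Z2" "Z2 \<subseteq> vs2.span W2" "finite W2"
    and B1: "vs1.subspace B1" "B1 \<subseteq> Z1"
    and B2: "vs2.subspace B2" "B2 \<subseteq> Z2"
    and fZ: "\<And>v. v \<in> Z1 \<Longrightarrow> f v \<in> Z2"
    and fB: "\<And>v. v \<in> Z1 \<Longrightarrow> f v \<in> B2 \<Longrightarrow> v \<in> B1"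
  shows "vs1.dim Z1 - vs1.dim B1 \<le> vs2.dim Z2 - vs2.dim B2"
proof -
  interpret f: Vector_Spaces.linear s1 s2 f by (fact lf)
  obtain b1 where b1: "b1 \<subseteq> B1" "vs1.independent b1" "B1 \<subseteq> vs1.span b1" "card b1 = vs1.dim B1"
    using vs1.basis_exists by blast
  obtain c where c: "b1 \<subseteq> c" "c \<subseteq> Z1" "vs1.independent c" "Z1 \<subseteq> vs1.span c"
    using vs1.maximal_independent_subset_extend[of b1 Z1] b1 B1 by blast
  obtain b2 where b2: "b2 \<subseteq> B2" "vs2.independent b2" "B2 \<subseteq> vs2.span b2" "card b2 = vs2.dim B2"
    using vs2.basis_exists by blast
  have span_b2: "vs2.span b2 = B2"
    using b2 B2(1) by (metis vs2.span_minimal subset_antisym)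
  have span_b1: "vs1.span b1 = B1"
    using b1 B1(1) by (metis vs1.span_minimal subset_antisym)
  have fin_c: "finite c"
    using vs1.independent_span_bound[of W1 c] Z1 c by blast
  have fin_b2: "finite b2"
    using vs2.independent_span_bound[of W2 b2] Z2 b2 B2 by blast
  have dim_c: "vs1.dim Z1 = card c"
    using c vs1.basis_card_eq_dim by metis
  define C where "C = c - b1"
  have indep: "vs2.independent (f ` C' \<union> b2) \<and> card (f ` C' \<union> b2) = card C' + card b2" if "C' \<subseteq> C" for C'
  proof -
    have "finite C'" using that fin_c unfolding C_def by (meson finite_Diff finite_subset)
    then show ?thesis using that
    proof (induction C' rule: finite_induct)
      case empty
      then show ?case using b2 by simp
    next
      case (insert x S)
      have xin: "x \<in> c" "x \<notin> b1" "x \<in> Z1" using insert.prems c unfolding C_def by auto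
      \<comment> \<open>If the new image depended on the earlier ones modulo \<open>B2\<close>, then
        x minus a combination of the earlier vectors would map into \<open>B2\<close>, hence lie in
        \<open>B1\<close> by \<open>fB\<close>, against the independence of
        \<open>c\<close>.\<close>
      have nin: "f x \<notin> vs2.span (f ` S \<union> b2)"
      proof
        assume "f x \<in> vs2.span (f ` S \<union> b2)"
        then obtain y z where yz: "f x = y + z" "y \<in> vs2.span (f ` S)" "z \<in> B2"
          unfolding vs2.span_Un span_b2 by blast
        then obtain u where u: "u \<in> vs1.span S" "y = f u"
          using f.span_image[of S] by auto
        have "S \<subseteq> c" using insert.prems unfolding C_def by auto
        then have "u \<in> Z1" using u c Z1(1) by (meson subsetD subset_trans vs1.span_minimal)
        moreover have "f (x - u) \<in> B2" using yz u by (simp add: f.diff)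
        ultimately have "x - u \<in> vs1.span b1" using fB[of "x - u"] xin Z1(1) span_b1
          by (simp add: vs1.subspace_diff)
        then have "x - u \<in> vs1.span (c - {x})"
          by (rule rev_subsetD) (rule vs1.span_mono, use c xin in auto)
        moreover have "u \<in> vs1.span (c - {x})"
          using u(1) by (rule rev_subsetD) (rule vs1.span_mono, use \<open>S \<subseteq> c\<close> insert in auto)
        ultimately have "x \<in> vs1.span (c - {x})"
          by (metis diff_add_cancel vs1.span_add)
        then show False using c(3) xin(1) unfolding vs1.dependent_def by blast
      qed
      have IH: "vs2.independent (f ` S \<union> b2)" "card (f ` S \<union> b2) = card S + card b2"
        using insert.IH insert.prems by simp_all
      have "f x \<notin> f ` S \<union> b2" using nin vs2.span_base[of "f x"] by metis
      moreover have "finite (f ` S \<union> b2)" using insert fin_b2 by simp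
      ultimately show ?case using IH nin insert.hyps vs2.independent_insertI[OF nin IH(1)] by simp
    qed
  qed
  have "f ` C \<union> b2 \<subseteq> Z2" using fZ c b2 B2 unfolding C_def by auto
  moreover obtain d where d: "d \<subseteq> Z2" "vs2.independent d" "Z2 \<subseteq> vs2.span d" "card d = vs2.dim Z2"
    using vs2.basis_exists by blast
  moreover have "finite d" using vs2.independent_span_bound[of W2 d] Z2 d by blast
  ultimately have "card (f ` C \<union> b2) \<le> vs2.dim Z2"
    using vs2.independent_span_bound[of d "f ` C \<union> b2"] indep[OF order_refl]
    by (metis subset_trans)
  then have "card C + vs2.dim B2 \<le> vs2.dim Z2" using indep[of C] b2 by simp
  moreover have "card C = vs1.dim Z1 - vs1.dim B1"
    using dim_c b1(4) c(1) fin_c unfolding C_def by (metis card_Diff_subset finite_subset)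
  ultimately show ?thesis by simp
qed

section \<open>Homogeneous components and constant coefficients\<close>

lift_definition hcomp :: "int \<Rightarrow> ('n::finite, 'k::field) mpoly \<Rightarrow> ('n, 'k) mpoly" is
  "\<lambda>d f m. f m when int (mdeg m) = d"
  by (rule finite_subset) auto

lemma lookup_hcomp: "Poly_Mapping.lookup (hcomp d f) m = (Poly_Mapping.lookup f m when int (mdeg m) = d)"
  by transfer rule

lemma keys_hcomp: "Poly_Mapping.keys (hcomp d f) = {m \<in> Poly_Mapping.keys f. int (mdeg m) = d}"
  by (auto simp: in_keys_iff lookup_hcomp)

lemma homogeneous_hcomp: "homogeneous d (hcomp d f)"
  by (simp add: homogeneous_def keys_hcomp)

lemma hcomp_add: "hcomp d (f + g) = hcomp d f + hcomp d g"
  by (rule poly_mapping_eqI) (simp add: lookup_hcomp lookup_add when_add_distrib)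

lemma hcomp_diff: "hcomp d (f - g) = hcomp d f - hcomp d g"
  by (rule poly_mapping_eqI) (simp add: lookup_hcomp lookup_minus when_diff_distrib)

lemma hcomp_zero [simp]: "hcomp d 0 = 0"
  by (rule poly_mapping_eqI) (simp add: lookup_hcomp)

lemma hcomp_sum: "hcomp d (sum f A) = (\<Sum>x\<in>A. hcomp d (f x))"
  by (induction A rule: infinite_finite_induct) (simp_all add: hcomp_add)

lemma hcomp_homogeneous: "homogeneous d f \<Longrightarrow> hcomp d f = f"
  by (rule poly_mapping_eqI) (auto simp: lookup_hcomp homogeneous_def in_keys_iff when_def)

lemma mdeg_add: "mdeg (a + b) = mdeg a + mdeg b"
  by (simp add: mdeg_def lookup_add sum.distrib)

lemma homogeneous_0 [simp]: "homogeneous d 0"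
  by (simp add: homogeneous_def)

lemma homogeneous_add: "homogeneous d f \<Longrightarrow> homogeneous d g \<Longrightarrow> homogeneous d (f + g)"
  using keys_add[of f g] unfolding homogeneous_def by blast

lemma homogeneous_uminus: "homogeneous d f \<Longrightarrow> homogeneous d (- f)"
  by (simp add: homogeneous_def in_keys_iff)

lemma homogeneous_diff: "homogeneous d f \<Longrightarrow> homogeneous d g \<Longrightarrow> homogeneous d (f - g)"
  using homogeneous_add[of d f "- g"] homogeneous_uminus[of d g] by simp

lemma homogeneous_sum: "(\<And>x. x \<in> A \<Longrightarrow> homogeneous d (f x)) \<Longrightarrow> homogeneous d (sum f A)"
  by (induction A rule: infinite_finite_induct) (simp_all add: homogeneous_add)

lemma homogeneous_mult:
  assumes "homogeneous a f" "homogeneous b g"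
  shows "homogeneous (a + b) (f * g)"
  using keys_mult[of f g] assms unfolding homogeneous_def by (fastforce simp: mdeg_add)

text \<open>Multiplication by a form of degree a shifts all degrees by a, so the part of g outside
  degree d - a contributes nothing in degree d.\<close>

lemma hcomp_mult:
  assumes "homogeneous a f"
  shows "hcomp d (f * g) = f * hcomp (d - a) g"
proof -
  define g' where "g' = g - hcomp (d - a) g"
  have *: "\<forall>m\<in>Poly_Mapping.keys g'. int (mdeg m) \<noteq> d - a"
    by (auto simp: g'_def in_keys_iff lookup_minus lookup_hcomp when_def)
  have "\<forall>m\<in>Poly_Mapping.keys (f * g'). int (mdeg m) \<noteq> d"
    using keys_mult[of f g'] * assms unfolding homogeneous_def by (fastforce simp: mdeg_add)
  then have "hcomp d (f * g') = 0"
    by (intro poly_mapping_eqI) (auto simp: lookup_hcomp in_keys_iff when_def)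
  moreover have "hcomp d (f * hcomp (d - a) g) = f * hcomp (d - a) g"
    using homogeneous_mult[OF assms homogeneous_hcomp[of "d - a" g]] by (simp add: hcomp_homogeneous)
  moreover have "f * g = f * g' + f * hcomp (d - a) g"
    by (simp add: g'_def algebra_simps)
  ultimately show ?thesis by (simp add: hcomp_add)
qed

text \<open>Two exponents add up to zero only if both are zero. This makes the constant coefficient
  a ring map onto the residue field, so products of matrices can be reduced entrywise.\<close>

lemma lookup_mult_0:
  fixes f g :: "('n::finite, 'k::field) mpoly"
  shows "Poly_Mapping.lookup (f * g) 0 = Poly_Mapping.lookup f 0 * Poly_Mapping.lookup g 0"
proof -
  have eq: "(0 = l + q) = (q = 0 \<and> l = 0)" for l q :: "'n \<Rightarrow>\<^sub>0 nat"
    by (metis add_is_0 lookup_add lookup_zero poly_mapping_eqI add_0)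
  have "Sum_any (\<lambda>q. Poly_Mapping.lookup g q when 0 = l + q) = (Poly_Mapping.lookup g 0 when l = 0)" for l :: "'n \<Rightarrow>\<^sub>0 nat"
    unfolding eq by (cases "l = 0") (simp_all)
  then show ?thesis
    by (simp add: lookup_mult mult_when)
qed

section \<open>Free modules, homogeneous vectors and graded matrices\<close>

text \<open>Over a field this is \<open>fscale\<close>; the general ring lets one set of facts about
  \<open>mat_map\<close> serve both the polynomial ring and its residue field.\<close>

definition vscale :: "'a::comm_ring_1 \<Rightarrow> (nat \<Rightarrow> 'a) \<Rightarrow> nat \<Rightarrow> 'a" where
  "vscale c v = (\<lambda>s. c * v s)"

interpretation vm: module "vscale :: 'a::comm_ring_1 \<Rightarrow> (nat \<Rightarrow> 'a) \<Rightarrow> nat \<Rightarrow> 'a"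
  by unfold_locales (auto simp: vscale_def fun_eq_iff algebra_simps)

definition unitv :: "nat \<Rightarrow> nat \<Rightarrow> 'a::comm_ring_1" where
  "unitv s = (\<lambda>t. if t = s then 1 else 0)"

lemma sum_fun_apply: "(\<Sum>x\<in>A. f x) t = (\<Sum>x\<in>A. f x t)"
  by (induction A rule: infinite_finite_induct) auto

lemma free_mod_expand:
  fixes v :: "nat \<Rightarrow> 'a::comm_ring_1"
  assumes "v \<in> free_mod r" shows "v = (\<Sum>s<r. vscale (v s) (unitv s))"
proof
  fix t
  have "(\<Sum>s<r. vscale (v s) (unitv s)) t = (\<Sum>s<r. if t = s then v s else 0)"
    by (rule trans[OF sum_fun_apply sum.cong]) (auto simp: vscale_def unitv_def)
  then show "v t = (\<Sum>s<r. vscale (v s) (unitv s)) t" using assms by (auto simp: free_mod_def not_less)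
qed

text \<open>Used with the zero submodule to compare two maps on a basis, and with the ideal as N to
  check congruences on a basis.\<close>

lemma module_hom_mem_subspace:
  fixes v :: "nat \<Rightarrow> 'a::comm_ring_1"
  assumes "module_hom vscale sc f" "module.subspace sc N" "\<And>s. s < r \<Longrightarrow> f (unitv s) \<in> N" "v \<in> free_mod r"
  shows "f v \<in> N"
proof -
  interpret f: module_hom vscale sc f by fact
  have "f v = (\<Sum>s<r. sc (v s) (f (unitv s)))"
    by (subst free_mod_expand[OF assms(4)]) (simp add: f.sum f.scale)
  then show ?thesis using assms(2,3) by (auto intro!: f.m2.subspace_sum f.m2.subspace_scale)
qed

lemma module_hom_mat_map: "module_hom vscale vscale (mat_map q r A)"
  by unfold_locales
    (auto simp: vscale_def mat_map_def fun_eq_iff algebra_simps sum.distrib sum_distrib_left)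

lemma mat_map_free [simp]: "mat_map q r A v \<in> free_mod q"
  by (simp add: mat_map_def free_mod_def)

lemma unitv_free: "s < r \<Longrightarrow> unitv s \<in> free_mod r"
  by (auto simp: unitv_def free_mod_def)

lemma mat_map_unitv: "s < r \<Longrightarrow> mat_map q r A (unitv s) = (\<lambda>t. if t < q then A t s else 0)"
  by (auto simp: mat_map_def unitv_def fun_eq_iff if_distrib cong: if_cong)

lemma module_hom_eqI:
  fixes v :: "nat \<Rightarrow> 'a::comm_ring_1"
  assumes "module_hom vscale vscale f" "module_hom vscale vscale g"
    "\<And>s. s < r \<Longrightarrow> f (unitv s) = g (unitv s)" "v \<in> free_mod r"
  shows "f v = g v"
proof -
  have "module_hom vscale vscale (\<lambda>v. f v - g v)"
    using assms(1,2) by (intro module_pair.module_hom_sub) (auto simp: module_pair_def module_hom_def)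
  then have "f v - g v \<in> {0}"
    by (rule module_hom_mem_subspace[where r = r]) (use assms in \<open>auto simp: vm.subspace_def\<close>)
  then show ?thesis by simp
qed

definition graded_mat :: "int list \<Rightarrow> int list \<Rightarrow> (nat \<Rightarrow> nat \<Rightarrow> ('n::finite, 'k::field) mpoly) \<Rightarrow> bool" where
  "graded_mat a b A \<longleftrightarrow> (\<forall>t<length a. \<forall>s<length b. homogeneous (b ! s - a ! t) (A t s))"

text \<open>The homogeneous elements of degree d in the direct sum of the shifts
  R(-\<open>a ! s\<close>), whence the degree of the coordinate s.\<close>

definition hvec :: "int list \<Rightarrow> int \<Rightarrow> (nat \<Rightarrow> ('n::finite, 'k::field) mpoly) \<Rightarrow> bool" where
  "hvec a d v \<longleftrightarrow> v \<in> free_mod (length a) \<and> (\<forall>s<length a. homogeneous (d - a ! s) (v s))"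

definition hcompv :: "int list \<Rightarrow> int \<Rightarrow> (nat \<Rightarrow> ('n::finite, 'k::field) mpoly) \<Rightarrow> nat \<Rightarrow> ('n, 'k) mpoly" where
  "hcompv a d v = (\<lambda>s. if s < length a then hcomp (d - a ! s) (v s) else 0)"

lemma hvec_hcompv: "hvec a d (hcompv a d v)"
  by (simp add: hvec_def hcompv_def free_mod_def homogeneous_hcomp)

lemma hcompv_hvec: "hvec a d v \<Longrightarrow> hcompv a d v = v"
  by (auto simp: hvec_def hcompv_def free_mod_def hcomp_homogeneous fun_eq_iff not_less)

lemma mat_map_hcompv:
  assumes "graded_mat a b A"
  shows "mat_map (length a) (length b) A (hcompv b d v) = hcompv a d (mat_map (length a) (length b) A v)"
proof -
  have "A t s * hcomp (d - b ! s) (v s) = hcomp (d - a ! t) (A t s * v s)"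
    if "t < length a" "s < length b" for t s
    using assms that hcomp_mult[of "b ! s - a ! t" "A t s" "d - a ! t" "v s"]
    by (simp add: graded_mat_def)
  then show ?thesis by (auto simp: mat_map_def hcompv_def hcomp_sum fun_eq_iff)
qed

lemma hvec_mat_map:
  assumes "graded_mat a b A" "hvec b d v"
  shows "hvec a d (mat_map (length a) (length b) A v)"
  using mat_map_hcompv[OF assms(1), of d v] hvec_hcompv[of a d] hcompv_hvec[OF assms(2)] by metis

lemma hvec_unitv: "s < length a \<Longrightarrow> hvec a (a ! s) (unitv s)"
  by (auto simp: hvec_def unitv_free) (auto simp: unitv_def homogeneous_def mdeg_def)

lemma hvec_diff: "hvec a d v \<Longrightarrow> hvec a d w \<Longrightarrow> hvec a d (v - w)"
  by (auto simp: hvec_def free_mod_def homogeneous_diff)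

text \<open>Freeness in matrix form: homogeneous images chosen for the basis elements become the
  columns of a graded matrix. The comparison maps and homotopies below are produced this
  way.\<close>

lemma graded_mat_choice:
  assumes "\<And>s. s < length b \<Longrightarrow> \<exists>w. hvec a (b ! s) w \<and> P s w"
  shows "\<exists>A. graded_mat a b A \<and> (\<forall>s<length b. P s (mat_map (length a) (length b) A (unitv s)))"
proof -
  obtain w where w: "\<And>s. s < length b \<Longrightarrow> hvec a (b ! s) (w s) \<and> P s (w s)" using assms by metis
  define A where "A = (\<lambda>t s. w s t)"
  have "mat_map (length a) (length b) A (unitv s) = w s" if "s < length b" for s
    using w[OF that] that unfolding mat_map_unitv[OF that] A_def
    by (auto simp: hvec_def free_mod_def fun_eq_iff)
  moreover have "graded_mat a b A" using w by (auto simp: graded_mat_def hvec_def A_def)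
  ultimately show ?thesis using w by metis
qed

section \<open>Graded resolutions: lifting, homotopies and comparison maps\<close>

definition hom_ideal :: "('n::finite, 'k::field) mpoly set \<Rightarrow> bool" where
  "hom_ideal I \<longleftrightarrow> module.subspace (*) I \<and> (\<forall>f\<in>I. \<forall>d. hcomp d f \<in> I)"

locale graded_res =
  fixes I :: "('n::finite, 'k::field) mpoly set" and ds D e
  assumes res: "graded_free_resolution I ds D e" and I: "hom_ideal I"
begin

abbreviation rk where "rk p \<equiv> length (ds p)"
abbreviation \<delta> where "\<delta> p \<equiv> mat_map (rk p) (rk (Suc p)) (D p)"
definition aug where "aug v = (\<Sum>s<rk 0. e s * v s)"
text \<open>At p = 0 the kernel of the map onto R/I replaces the kernel of a differential, so that
  exactness has the same form for all p.\<close>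

definition cyc where "cyc p = (case p of 0 \<Rightarrow> {v. aug v \<in> I} | Suc q \<Rightarrow> {v. \<delta> q v = 0})"

lemma aug_surj: "\<exists>v\<in>free_mod (rk 0). f - aug v \<in> I"
  using res by (simp add: graded_free_resolution_def Let_def aug_def)

lemma graded_D: "graded_mat (ds p) (ds (Suc p)) (D p)"
  using res by (simp add: graded_free_resolution_def Let_def graded_mat_def)

lemma cyc_eq: "{v \<in> free_mod (rk p). v \<in> cyc p} = \<delta> p ` free_mod (rk (Suc p))"
  using res by (cases p) (simp_all add: graded_free_resolution_def Let_def aug_def cyc_def zero_fun_def)

lemma exact: "v \<in> free_mod (rk p) \<Longrightarrow> v \<in> cyc p \<Longrightarrow> \<exists>w. v = \<delta> p w"
  using cyc_eq[of p] by blast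

lemma \<delta>_in_cyc: "w \<in> free_mod (rk (Suc p)) \<Longrightarrow> \<delta> p w \<in> cyc p"
  using cyc_eq[of p] by blast

lemma homogeneous_e: "s < rk 0 \<Longrightarrow> homogeneous (ds 0 ! s) (e s)"
  using res by (simp add: graded_free_resolution_def Let_def)

lemma module_hom_aug: "module_hom vscale (*) aug"
  by (intro module_hom.intro module_hom_axioms.intro vm.module_axioms module_times)
    (auto simp: aug_def vscale_def sum.distrib algebra_simps sum_distrib_left)

lemma aug_unitv: "s < rk 0 \<Longrightarrow> aug (unitv s) = e s"
  by (simp add: aug_def unitv_def if_distrib cong: if_cong)

lemma aug_hcompv: "aug (hcompv (ds 0) d v) = hcomp d (aug v)"
proof -
  have "e s * hcomp (d - ds 0 ! s) (v s) = hcomp d (e s * v s)" if "s < rk 0" for s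
    using hcomp_mult[OF homogeneous_e[OF that], of d "v s"] by simp
  then show ?thesis by (simp add: aug_def hcompv_def hcomp_sum)
qed

text \<open>Any preimage under the differential can be cut down to its component of degree d, as a
  graded map commutes with taking components.\<close>

lemma lift_cyc:
  assumes "hvec (ds p) d v" "v \<in> cyc p"
  shows "\<exists>w. hvec (ds (Suc p)) d w \<and> \<delta> p w = v"
proof -
  obtain w where "v = \<delta> p w" using exact[of v p] assms by (auto simp: hvec_def)
  then have "\<delta> p (hcompv (ds (Suc p)) d w) = v"
    using mat_map_hcompv[OF graded_D, of p d w] assms by (simp add: hcompv_hvec)
  then show ?thesis using hvec_hcompv by blast
qed

lemma lift_aug:
  assumes "homogeneous d f"
  shows "\<exists>v. hvec (ds 0) d v \<and> f - aug v \<in> I"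
proof -
  obtain v where "f - aug v \<in> I" using aug_surj by blast
  then have "hcomp d (f - aug v) \<in> I" using I by (simp add: hom_ideal_def)
  then have "f - aug (hcompv (ds 0) d v) \<in> I"
    using assms by (simp add: hcomp_diff hcomp_homogeneous aug_hcompv)
  then show ?thesis using hvec_hcompv by blast
qed

end

lemma module_hom_diff_fun:
  assumes "module_hom vscale vscale f" "module_hom vscale vscale g"
  shows "module_hom vscale vscale (\<lambda>v. f v - g v)"
  using assms by (intro module_pair.module_hom_sub) (auto simp: module_pair_def module_hom_def)

lemma module_hom_comp:
  assumes "module_hom vscale vscale f" "module_hom vscale vscale g"
  shows "module_hom vscale vscale (\<lambda>v. f (g v))"
  using module_hom_compose[OF assms(2,1)] by (simp add: comp_def)

lemma free_mod_diff: "v \<in> free_mod r \<Longrightarrow> w \<in> free_mod r \<Longrightarrow> v - w \<in> free_mod r"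
  for v w :: "nat \<Rightarrow> 'a::comm_ring_1"
  by (auto simp: free_mod_def)

lemma (in graded_res) \<delta>_\<delta>: "v \<in> free_mod (rk (Suc (Suc p))) \<Longrightarrow> \<delta> p (\<delta> (Suc p) v) = 0"
  using \<delta>_in_cyc[of v "Suc p"] by (simp add: cyc_def)

text \<open>A graded chain map that induces zero on R/I is null-homotopic. Endomorphisms suffice,
  since \<open>T\<close> will be the composite of two comparison maps minus the identity.\<close>

lemma (in graded_res) homotopy_exists:
  assumes hom: "\<And>p. module_hom vscale vscale (T p)"
    and free: "\<And>p v. v \<in> free_mod (rk p) \<Longrightarrow> T p v \<in> free_mod (rk p)"
    and hv: "\<And>p d v. hvec (ds p) d v \<Longrightarrow> hvec (ds p) d (T p v)"
    and chain: "\<And>p v. v \<in> free_mod (rk (Suc p)) \<Longrightarrow> \<delta> p (T (Suc p) v) = T p (\<delta> p v)"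
    and aug_T: "\<And>v. v \<in> free_mod (rk 0) \<Longrightarrow> aug (T 0 v) \<in> I"
  defines "H \<equiv> \<lambda>p. mat_map (rk (Suc p)) (rk p)"
  shows "\<exists>h. (\<forall>p. graded_mat (ds (Suc p)) (ds p) (h p)) \<and>
    (\<forall>v\<in>free_mod (rk 0). T 0 v = \<delta> 0 (H 0 (h 0) v)) \<and>
    (\<forall>p. \<forall>v\<in>free_mod (rk (Suc p)). T (Suc p) v = H p (h p) (\<delta> p v) + \<delta> (Suc p) (H (Suc p) (h (Suc p)) v))"
proof -
  \<comment> \<open>\<open>P\<close> is the invariant of the recursion: after subtraction of the
    homotopy term the next component of \<open>T\<close> takes values in cycles and can be lifted.
    Its clause for p = 0 records the first homotopy equation; \<open>Q\<close> ties consecutive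
    matrices by the later ones.\<close>
  define P where "P = (\<lambda>p A. graded_mat (ds (Suc p)) (ds p) A \<and>
    (\<forall>v\<in>free_mod (rk (Suc p)). \<delta> p (T (Suc p) v - H p A (\<delta> p v)) = 0) \<and>
    (p = 0 \<longrightarrow> (\<forall>v\<in>free_mod (rk 0). T 0 v = \<delta> 0 (H 0 A v))))"
  define Q where "Q = (\<lambda>p A B. \<forall>v\<in>free_mod (rk (Suc p)).
    T (Suc p) v - H p A (\<delta> p v) = \<delta> (Suc p) (H (Suc p) B v))"
  have homH: "module_hom vscale vscale (H p A)" for p A by (simp add: H_def module_hom_mat_map)
  have hom\<delta>: "module_hom vscale vscale (\<delta> p)" for p by (rule module_hom_mat_map)
  have "\<exists>A. P 0 A"
  proof -
    have "\<exists>w. hvec (ds (Suc 0)) (ds 0 ! s) w \<and> \<delta> 0 w = T 0 (unitv s)" if "s < rk 0" for s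
      using that by (intro lift_cyc hv hvec_unitv) (auto simp: cyc_def intro!: aug_T unitv_free)
    then obtain A where A: "graded_mat (ds (Suc 0)) (ds 0) A"
      "\<And>s. s < rk 0 \<Longrightarrow> \<delta> 0 (H 0 A (unitv s)) = T 0 (unitv s)"
      using graded_mat_choice[of "ds 0" "ds (Suc 0)" "\<lambda>s w. \<delta> 0 w = T 0 (unitv s)"]
      unfolding H_def by blast
    have eq: "T 0 v = \<delta> 0 (H 0 A v)" if "v \<in> free_mod (rk 0)" for v
      by (rule module_hom_eqI[OF hom module_hom_comp[OF hom\<delta> homH] _ that]) (simp add: A)
    have "\<delta> 0 (T (Suc 0) v - H 0 A (\<delta> 0 v)) = 0" if "v \<in> free_mod (rk (Suc 0))" for v
      using chain[OF that] eq[of "\<delta> 0 v"] by (simp add: module_hom.diff[OF hom\<delta>])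
    then show ?thesis using A eq unfolding P_def by auto
  qed
  moreover have "\<exists>B. P (Suc p) B \<and> Q p A B" if "P p A" for p A
  proof -
    define S where "S = (\<lambda>v. T (Suc p) v - H p A (\<delta> p v))"
    have homS: "module_hom vscale vscale S"
      unfolding S_def by (rule module_hom_diff_fun[OF hom module_hom_comp[OF homH hom\<delta>]])
    have "\<exists>w. hvec (ds (Suc (Suc p))) (ds (Suc p) ! s) w \<and> \<delta> (Suc p) w = S (unitv s)" if s: "s < rk (Suc p)" for s
    proof (rule lift_cyc)
      show "hvec (ds (Suc p)) (ds (Suc p) ! s) (S (unitv s))"
        unfolding S_def H_def using \<open>P p A\<close> s
        by (intro hvec_diff hv hvec_unitv hvec_mat_map graded_D) (auto simp: P_def)
      show "S (unitv s) \<in> cyc (Suc p)"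
        using \<open>P p A\<close> unitv_free[OF s] by (auto simp: P_def cyc_def S_def)
    qed
    then obtain B where B: "graded_mat (ds (Suc (Suc p))) (ds (Suc p)) B"
      "\<And>s. s < rk (Suc p) \<Longrightarrow> \<delta> (Suc p) (H (Suc p) B (unitv s)) = S (unitv s)"
      using graded_mat_choice[of "ds (Suc p)" "ds (Suc (Suc p))" "\<lambda>s w. \<delta> (Suc p) w = S (unitv s)"]
      unfolding H_def by blast
    have eq: "S v = \<delta> (Suc p) (H (Suc p) B v)" if "v \<in> free_mod (rk (Suc p))" for v
      by (rule module_hom_eqI[OF homS module_hom_comp[OF hom\<delta> homH] _ that]) (simp add: B)
    have "\<delta> (Suc p) (T (Suc (Suc p)) v - H (Suc p) B (\<delta> (Suc p) v)) = 0" if "v \<in> free_mod (rk (Suc (Suc p)))" for v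
    proof -
      \<comment> \<open>The older homotopy term disappears on boundaries, as two consecutive
        differentials compose to zero.\<close>
      have "H p A (\<delta> p (\<delta> (Suc p) v)) = 0"
        using \<delta>_\<delta>[OF that] by (simp add: module_hom.zero[OF homH])
      then show ?thesis
        using chain[OF that] eq[of "\<delta> (Suc p) v"] by (simp add: module_hom.diff[OF hom\<delta>] S_def)
    qed
    then show ?thesis using B eq unfolding P_def Q_def S_def by auto
  qed
  ultimately obtain h where h: "\<And>p. P p (h p)" "\<And>p. Q p (h p) (h (Suc p))"
    using dependent_nat_choice[of P Q] by metis
  have "T (Suc p) v = H p (h p) (\<delta> p v) + \<delta> (Suc p) (H (Suc p) (h (Suc p)) v)"
    if "v \<in> free_mod (rk (Suc p))" for p v
    using h(2)[of p] that unfolding Q_def by (metis add.commute diff_add_cancel)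
  then show ?thesis
    by (intro exI[of _ h] conjI allI) (use h(1) in \<open>simp_all add: P_def\<close>)
qed

locale graded_res_pair = F: graded_res I ds D e + G: graded_res I ds' D' e'
  for I :: "('n::finite, 'k::field) mpoly set" and ds D e ds' D' e'
begin

text \<open>The identity of R/I is lifted one degree at a time. The recursion keeps cycles mapped to
  cycles, which is what lifting the next basis elements through the exact target complex
  requires.\<close>

lemma chain_map_exists:
  defines "M \<equiv> \<lambda>p. mat_map (G.rk p) (F.rk p)"
  shows "\<exists>\<phi>. (\<forall>p. graded_mat (ds' p) (ds p) (\<phi> p)) \<and>
    (\<forall>v\<in>free_mod (F.rk 0). F.aug v - G.aug (M 0 (\<phi> 0) v) \<in> I) \<and>
    (\<forall>p. \<forall>v\<in>free_mod (F.rk (Suc p)). G.\<delta> p (M (Suc p) (\<phi> (Suc p)) v) = M p (\<phi> p) (F.\<delta> p v))"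
proof -
  define P where "P = (\<lambda>p A. graded_mat (ds' p) (ds p) A \<and>
    (\<forall>v\<in>free_mod (F.rk p). v \<in> F.cyc p \<longrightarrow> M p A v \<in> G.cyc p) \<and>
    (p = 0 \<longrightarrow> (\<forall>v\<in>free_mod (F.rk 0). F.aug v - G.aug (M 0 A v) \<in> I)))"
  define Q where "Q = (\<lambda>p A B. \<forall>v\<in>free_mod (F.rk (Suc p)).
    G.\<delta> p (M (Suc p) B v) = M p A (F.\<delta> p v))"
  have homM: "module_hom vscale vscale (M p A)" for p A by (simp add: M_def module_hom_mat_map)
  have I: "module.subspace (*) I" using F.I by (simp add: hom_ideal_def)
  have "\<exists>A. P 0 A"
  proof -
    have "\<exists>w. hvec (ds' 0) (ds 0 ! s) w \<and> F.aug (unitv s) - G.aug w \<in> I" if "s < F.rk 0" for s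
      using G.lift_aug[OF F.homogeneous_e[OF that]] F.aug_unitv[OF that] by simp
    then obtain A where A: "graded_mat (ds' 0) (ds 0) A"
      "\<And>s. s < F.rk 0 \<Longrightarrow> F.aug (unitv s) - G.aug (M 0 A (unitv s)) \<in> I"
      using graded_mat_choice[of "ds 0" "ds' 0" "\<lambda>s w. F.aug (unitv s) - G.aug w \<in> I"]
      unfolding M_def by blast
    have hom: "module_hom vscale (*) (\<lambda>v. F.aug v - G.aug (M 0 A v))"
      using module_hom_compose[OF homM G.module_hom_aug] F.module_hom_aug
      by (intro module_pair.module_hom_sub) (auto simp: module_pair_def module_hom_def comp_def)
    have eq: "F.aug v - G.aug (M 0 A v) \<in> I" if "v \<in> free_mod (F.rk 0)" for v
      by (rule module_hom_mem_subspace[OF hom I _ that]) (simp add: A)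
    have "G.aug (M 0 A v) \<in> I" if "v \<in> free_mod (F.rk 0)" "F.aug v \<in> I" for v
      using module.subspace_diff[OF module_times I that(2) eq[OF that(1)]] by simp
    then show ?thesis using A eq unfolding P_def by (auto simp: F.cyc_def G.cyc_def)
  qed
  moreover have "\<exists>B. P (Suc p) B \<and> Q p A B" if "P p A" for p A
  proof -
    have "\<exists>w. hvec (ds' (Suc p)) (ds (Suc p) ! s) w \<and> G.\<delta> p w = M p A (F.\<delta> p (unitv s))" if s: "s < F.rk (Suc p)" for s
    proof (rule G.lift_cyc)
      show "hvec (ds' p) (ds (Suc p) ! s) (M p A (F.\<delta> p (unitv s)))"
        unfolding M_def using \<open>P p A\<close> s
        by (intro hvec_unitv hvec_mat_map F.graded_D) (auto simp: P_def)
      show "M p A (F.\<delta> p (unitv s)) \<in> G.cyc p"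
        using \<open>P p A\<close> F.\<delta>_in_cyc[OF unitv_free[OF s]] by (auto simp: P_def)
    qed
    then obtain B where B: "graded_mat (ds' (Suc p)) (ds (Suc p)) B"
      "\<And>s. s < F.rk (Suc p) \<Longrightarrow> G.\<delta> p (M (Suc p) B (unitv s)) = M p A (F.\<delta> p (unitv s))"
      using graded_mat_choice[of "ds (Suc p)" "ds' (Suc p)" "\<lambda>s w. G.\<delta> p w = M p A (F.\<delta> p (unitv s))"]
      unfolding M_def by blast
    have eq: "G.\<delta> p (M (Suc p) B v) = M p A (F.\<delta> p v)" if "v \<in> free_mod (F.rk (Suc p))" for v
      by (rule module_hom_eqI[OF module_hom_comp[OF module_hom_mat_map homM] module_hom_comp[OF homM module_hom_mat_map] _ that])
        (simp add: B)
    then show ?thesis using B module_hom.zero[OF homM]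
      unfolding P_def Q_def by (auto simp: F.cyc_def G.cyc_def)
  qed
  ultimately obtain \<phi> where \<phi>: "\<And>p. P p (\<phi> p)" "\<And>p. Q p (\<phi> p) (\<phi> (Suc p))"
    using dependent_nat_choice[of P Q] by metis
  then show ?thesis
    by (intro exI[of _ \<phi>] conjI allI) (use \<phi> in \<open>simp_all add: P_def Q_def\<close>)
qed

end

section \<open>Reduction modulo the variables\<close>

definition const_coeffs :: "(nat \<Rightarrow> ('n::finite, 'k::field) mpoly) \<Rightarrow> nat \<Rightarrow> 'k" where
  "const_coeffs v = (\<lambda>s. Poly_Mapping.lookup (v s) 0)"

abbreviation const_mat :: "(nat \<Rightarrow> nat \<Rightarrow> ('n::finite, 'k::field) mpoly) \<Rightarrow> nat \<Rightarrow> nat \<Rightarrow> 'k" where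
  "const_mat A \<equiv> \<lambda>t s. Poly_Mapping.lookup (A t s) 0"

lemma const_coeffs_mat_map: "const_coeffs (mat_map q r A v) = mat_map q r (const_mat A) (const_coeffs v)"
  by (auto simp: const_coeffs_def mat_map_def fun_eq_iff lookup_sum lookup_mult_0)

lemma const_coeffs_diff: "const_coeffs (v - w) = const_coeffs v - const_coeffs w"
  by (simp add: const_coeffs_def fun_eq_iff lookup_minus)

lemma const_coeffs_add: "const_coeffs (v + w) = const_coeffs v + const_coeffs w"
  by (simp add: const_coeffs_def fun_eq_iff lookup_add)

lemma const_coeffs_zero [simp]: "const_coeffs 0 = 0"
  by (simp add: const_coeffs_def fun_eq_iff)

text \<open>Vectors over the field lift to constant polynomials, so identities proved over the
  polynomial ring descend to the complex tensored with the field.\<close>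

lemma exists_const_coeffs:
  assumes "v \<in> free_mod r"
  shows "\<exists>w :: nat \<Rightarrow> ('n::finite, 'k::field) mpoly. w \<in> free_mod r \<and> const_coeffs w = v"
  using assms by (intro exI[of _ "\<lambda>s. Poly_Mapping.single 0 (v s)"]) (simp add: free_mod_def const_coeffs_def)

lemma fscale_eq_vscale: "fscale = vscale"
  by (simp add: fscale_def vscale_def fun_eq_iff)

lemma linear_mat_map: "Vector_Spaces.linear fscale fscale (mat_map q r (A :: nat \<Rightarrow> nat \<Rightarrow> 'k::field))"
  using module_hom_mat_map[of q r A] unfolding fscale_eq_vscale[symmetric]
  by (simp add: module_hom_iff_linear)

interpretation fun_vs_pair: vector_space_pair "fscale :: 'k::field \<Rightarrow> _" "fscale :: 'k \<Rightarrow> _" ..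

lemma tor_chains_free: "v \<in> tor_chains ds i j \<Longrightarrow> v \<in> free_mod (length (ds i))"
  by (simp add: tor_chains_def)

lemma subspace_tor_chains: "fun_vs.subspace (tor_chains ds i j)"
  by (auto simp: fun_vs.subspace_def tor_chains_def free_mod_def fscale_def)

lemma tor_chains_finite_span: "\<exists>W. finite W \<and> (tor_chains ds i j :: (nat \<Rightarrow> 'k::field) set) \<subseteq> fun_vs.span W"
proof -
  have "v \<in> fun_vs.span (unitv ` {..<length (ds i)})" if "v \<in> tor_chains ds i j" for v :: "nat \<Rightarrow> 'k"
    by (subst free_mod_expand[OF tor_chains_free[OF that]], unfold fscale_eq_vscale[symmetric],
        intro fun_vs.span_sum fun_vs.span_scale fun_vs.span_base imageI)
  then show ?thesis by (intro exI[of _ "unitv ` {..<length (ds i)}"]) auto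
qed

text \<open>A nonzero constant coefficient forces the matrix entry to have degree 0, so it joins
  basis elements of equal degree.\<close>

lemma mat_map_tor_chains:
  assumes "graded_mat (ds' q) (ds p) A" "v \<in> tor_chains ds p j"
  shows "mat_map (length (ds' q)) (length (ds p)) (const_mat A) v \<in> tor_chains ds' q j"
proof -
  have "ds' q ! t = j" if t: "t < length (ds' q)" "(\<Sum>s<length (ds p). const_mat A t s * v s) \<noteq> 0" for t
  proof -
    obtain s where s: "s < length (ds p)" "const_mat A t s \<noteq> 0" "v s \<noteq> 0"
      using sum.not_neutral_contains_not_neutral[OF t(2)] by auto
    have "0 \<in> Poly_Mapping.keys (A t s)" using s by (simp add: in_keys_iff)
    moreover have "homogeneous (ds p ! s - ds' q ! t) (A t s)"
      using assms(1) t(1) s(1) by (simp add: graded_mat_def)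
    ultimately have "ds p ! s - ds' q ! t = 0"
      by (auto simp: homogeneous_def mdeg_def)
    moreover have "ds p ! s = j" using s assms(2) by (simp add: tor_chains_def)
    ultimately show ?thesis by simp
  qed
  then show ?thesis by (auto simp: tor_chains_def mat_map_def free_mod_def)
qed

context graded_res begin

lemma tor_diff_chains: "v \<in> tor_chains ds (Suc i) j \<Longrightarrow> tor_diff ds D i v \<in> tor_chains ds i j"
  unfolding tor_diff_def by (rule mat_map_tor_chains[where ds = ds and ds' = ds]) (rule graded_D)

lemma tor_diff_diff:
  assumes "v \<in> tor_chains ds (Suc (Suc i)) j"
  shows "tor_diff ds D i (tor_diff ds D (Suc i) v) = 0"
proof -
  obtain w :: "nat \<Rightarrow> ('n, 'k) mpoly" where w: "w \<in> free_mod (rk (Suc (Suc i)))" "const_coeffs w = v"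
    using exists_const_coeffs[OF tor_chains_free[OF assms]] by blast
  show ?thesis using arg_cong[OF \<delta>_\<delta>[OF w(1)], of const_coeffs] w(2)
    by (simp add: const_coeffs_mat_map tor_diff_def)
qed

lemma linear_tor_diff: "Vector_Spaces.linear fscale fscale (tor_diff ds D i)"
  unfolding tor_diff_def by (rule linear_mat_map)

lemma subspace_tor_cycles: "fun_vs.subspace (tor_cycles ds D i j)"
proof (cases i)
  case 0
  then show ?thesis by (simp add: tor_cycles_def subspace_tor_chains)
next
  case (Suc p)
  interpret f: Vector_Spaces.linear fscale fscale "tor_diff ds D p" by (rule linear_tor_diff)
  have "tor_cycles ds D i j = tor_chains ds i j \<inter> {v. tor_diff ds D p v = 0}"
    by (auto simp: tor_cycles_def Suc zero_fun_def)
  then show ?thesis by (simp only:) (intro fun_vs.subspace_inter subspace_tor_chains f.subspace_kernel)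
qed

lemma subspace_tor_boundaries: "fun_vs.subspace (tor_boundaries ds D i j)"
proof -
  interpret f: Vector_Spaces.linear fscale fscale "tor_diff ds D i" by (rule linear_tor_diff)
  show ?thesis unfolding tor_boundaries_def by (rule f.subspace_image[OF subspace_tor_chains])
qed

lemma tor_boundaries_cycles: "tor_boundaries ds D i j \<subseteq> tor_cycles ds D i j"
  using tor_diff_chains tor_diff_diff
  by (cases i) (auto simp: tor_boundaries_def tor_cycles_def zero_fun_def[symmetric])

lemma tor_cycles_chains: "tor_cycles ds D i j \<subseteq> tor_chains ds i j"
  by (cases i) (auto simp: tor_cycles_def)

lemma tor_cycles_finite_span: "\<exists>W. finite W \<and> tor_cycles ds D i j \<subseteq> fun_vs.span W"
  using tor_chains_finite_span[of ds i j] tor_cycles_chains[of i j] by (meson subset_trans)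

end

text \<open>The composite of the two comparison maps is homotopic to the identity, so the first of
  them is injective on homology. Equality follows by exchanging the two resolutions.\<close>

lemma (in graded_res_pair) tor_dim_le: "tor_dim ds D i j \<le> tor_dim ds' D' i j"
proof -
  interpret G': graded_res_pair I ds' D' e' ds D e ..
  define M where "M = (\<lambda>p. mat_map (G.rk p) (F.rk p) :: _ \<Rightarrow> (nat \<Rightarrow> ('n, 'k) mpoly) \<Rightarrow> _)"
  define N where "N = (\<lambda>p. mat_map (F.rk p) (G.rk p) :: _ \<Rightarrow> (nat \<Rightarrow> ('n, 'k) mpoly) \<Rightarrow> _)"
  obtain \<phi> where \<phi>: "\<And>p. graded_mat (ds' p) (ds p) (\<phi> p)"
    "\<And>v. v \<in> free_mod (F.rk 0) \<Longrightarrow> F.aug v - G.aug (M 0 (\<phi> 0) v) \<in> I"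
    "\<And>p v. v \<in> free_mod (F.rk (Suc p)) \<Longrightarrow> G.\<delta> p (M (Suc p) (\<phi> (Suc p)) v) = M p (\<phi> p) (F.\<delta> p v)"
    using chain_map_exists unfolding M_def by metis
  obtain \<psi> where \<psi>: "\<And>p. graded_mat (ds p) (ds' p) (\<psi> p)"
    "\<And>v. v \<in> free_mod (G.rk 0) \<Longrightarrow> G.aug v - F.aug (N 0 (\<psi> 0) v) \<in> I"
    "\<And>p v. v \<in> free_mod (G.rk (Suc p)) \<Longrightarrow> F.\<delta> p (N (Suc p) (\<psi> (Suc p)) v) = N p (\<psi> p) (G.\<delta> p v)"
    using G'.chain_map_exists unfolding N_def by metis
  have I: "module.subspace (*) I" using F.I by (simp add: hom_ideal_def)
  define T where "T = (\<lambda>p v. N p (\<psi> p) (M p (\<phi> p) v) - v)"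
  have Mf: "M p A v \<in> free_mod (G.rk p)" for p A v by (simp add: M_def)
  have hom\<delta>: "module_hom vscale vscale (F.\<delta> p)" for p by (rule module_hom_mat_map)
  have "\<exists>h. (\<forall>p. graded_mat (ds (Suc p)) (ds p) (h p)) \<and>
    (\<forall>v\<in>free_mod (F.rk 0). T 0 v = F.\<delta> 0 (mat_map (F.rk (Suc 0)) (F.rk 0) (h 0) v)) \<and>
    (\<forall>p. \<forall>v\<in>free_mod (F.rk (Suc p)). T (Suc p) v = mat_map (F.rk (Suc p)) (F.rk p) (h p) (F.\<delta> p v)
       + F.\<delta> (Suc p) (mat_map (F.rk (Suc (Suc p))) (F.rk (Suc p)) (h (Suc p)) v))"
  proof (rule F.homotopy_exists)
    show "module_hom vscale vscale (T p)" for p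
      unfolding T_def M_def N_def
      by (rule module_hom_diff_fun[OF module_hom_comp[OF module_hom_mat_map module_hom_mat_map] vm.module_hom_ident])
    show "T p v \<in> free_mod (F.rk p)" if "v \<in> free_mod (F.rk p)" for p v
      unfolding T_def N_def using that by (intro free_mod_diff mat_map_free)
    show "hvec (ds p) d (T p v)" if "hvec (ds p) d v" for p d v
      unfolding T_def M_def N_def using that by (intro hvec_diff hvec_mat_map \<phi> \<psi>)
    show "F.\<delta> p (T (Suc p) v) = T p (F.\<delta> p v)" if "v \<in> free_mod (F.rk (Suc p))" for p v
      unfolding T_def module_hom.diff[OF hom\<delta>] by (simp add: \<psi>(3)[OF Mf] \<phi>(3)[OF that])
    show "F.aug (T 0 v) \<in> I" if v: "v \<in> free_mod (F.rk 0)" for v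
    proof -
      \<comment> \<open>Both comparison maps lift the identity of R/I, so their two congruences
        modulo \<open>I\<close> add up.\<close>
      have "F.aug (T 0 v) = - ((G.aug (M 0 (\<phi> 0) v) - F.aug (N 0 (\<psi> 0) (M 0 (\<phi> 0) v)))
          + (F.aug v - G.aug (M 0 (\<phi> 0) v)))"
        unfolding T_def module_hom.diff[OF F.module_hom_aug] by simp
      also have "\<dots> \<in> I"
        by (intro module.subspace_neg[OF module_times I] module.subspace_add[OF module_times I] \<phi>(2) \<psi>(2) v Mf)
      finally show ?thesis .
    qed
  qed
  then obtain h where h: "\<And>p. graded_mat (ds (Suc p)) (ds p) (h p)"
    "\<And>v. v \<in> free_mod (F.rk 0) \<Longrightarrow> T 0 v = F.\<delta> 0 (mat_map (F.rk (Suc 0)) (F.rk 0) (h 0) v)"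
    "\<And>p v. v \<in> free_mod (F.rk (Suc p)) \<Longrightarrow> T (Suc p) v = mat_map (F.rk (Suc p)) (F.rk p) (h p) (F.\<delta> p v)
       + F.\<delta> (Suc p) (mat_map (F.rk (Suc (Suc p))) (F.rk (Suc p)) (h (Suc p)) v)"
    by metis
  define f where "f = (\<lambda>p. mat_map (G.rk p) (F.rk p) (const_mat (\<phi> p)))"
  define g where "g = (\<lambda>p. mat_map (F.rk p) (G.rk p) (const_mat (\<psi> p)))"
  define k where "k = (\<lambda>p. mat_map (F.rk (Suc p)) (F.rk p) (const_mat (h p)))"
  have f_ch: "f p v \<in> tor_chains ds' p j" if "v \<in> tor_chains ds p j" for p v
    unfolding f_def by (rule mat_map_tor_chains[where ds = ds and ds' = ds', OF _ that]) (rule \<phi>(1))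
  have g_ch: "g p v \<in> tor_chains ds p j" if "v \<in> tor_chains ds' p j" for p v
    unfolding g_def by (rule mat_map_tor_chains[where ds = ds' and ds' = ds, OF _ that]) (rule \<psi>(1))
  have k_ch: "k p v \<in> tor_chains ds (Suc p) j" if "v \<in> tor_chains ds p j" for p v
    unfolding k_def by (rule mat_map_tor_chains[where ds = ds and ds' = ds, OF _ that]) (rule h(1))
  have f_d: "tor_diff ds' D' p (f (Suc p) v) = f p (tor_diff ds D p v)" if v: "v \<in> tor_chains ds (Suc p) j" for p v
  proof -
    obtain w :: "nat \<Rightarrow> ('n, 'k) mpoly" where w: "w \<in> free_mod (F.rk (Suc p))" "const_coeffs w = v"
      using exists_const_coeffs[OF tor_chains_free[OF v]] by blast
    show ?thesis using arg_cong[OF \<phi>(3)[OF w(1)], of const_coeffs] w(2)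
      by (simp add: const_coeffs_mat_map tor_diff_def f_def M_def)
  qed
  have g_d: "tor_diff ds D p (g (Suc p) v) = g p (tor_diff ds' D' p v)" if v: "v \<in> tor_chains ds' (Suc p) j" for p v
  proof -
    obtain w :: "nat \<Rightarrow> ('n, 'k) mpoly" where w: "w \<in> free_mod (G.rk (Suc p))" "const_coeffs w = v"
      using exists_const_coeffs[OF tor_chains_free[OF v]] by blast
    show ?thesis using arg_cong[OF \<psi>(3)[OF w(1)], of const_coeffs] w(2)
      by (simp add: const_coeffs_mat_map tor_diff_def g_def N_def)
  qed
  have gf: "g i (f i v) - v \<in> tor_boundaries ds D i j" if v: "v \<in> tor_cycles ds D i j" for v
  proof -
    have vch: "v \<in> tor_chains ds i j" using v F.tor_cycles_chains by blast
    obtain w :: "nat \<Rightarrow> ('n, 'k) mpoly" where w: "w \<in> free_mod (F.rk i)" "const_coeffs w = v"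
      using exists_const_coeffs[OF tor_chains_free[OF vch]] by blast
    have "g i (f i v) - v = const_coeffs (T i w)"
      by (simp add: T_def const_coeffs_diff w(2) M_def N_def f_def g_def const_coeffs_mat_map)
    also have "\<dots> = tor_diff ds D i (k i v)"
    proof (cases i)
      case 0
      then show ?thesis using h(2)[of w] w
        by (simp add: const_coeffs_mat_map tor_diff_def k_def)
    next
      case (Suc p)
      \<comment> \<open>On a cycle the homotopy summand containing the differential of v is zero,
        and the other summand is a boundary.\<close>
      have "tor_diff ds D p v = 0" using v by (simp add: Suc tor_cycles_def zero_fun_def)
      moreover have "k p 0 = 0" unfolding k_def by (rule module_hom.zero[OF module_hom_mat_map])
      ultimately show ?thesis using h(3)[of w p] w
        by (simp add: Suc const_coeffs_mat_map const_coeffs_add tor_diff_def k_def)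
    qed
    finally show ?thesis using k_ch[OF vch] by (auto simp: tor_boundaries_def)
  qed
  interpret lg: Vector_Spaces.linear fscale fscale "g i" unfolding g_def by (rule linear_mat_map)
  obtain W where W: "finite W" "tor_cycles ds D i j \<subseteq> fun_vs.span W"
    using F.tor_cycles_finite_span by blast
  obtain W' where W': "finite W'" "tor_cycles ds' D' i j \<subseteq> fun_vs.span W'"
    using G.tor_cycles_finite_span by blast
  show ?thesis unfolding tor_dim_def
  proof (rule fun_vs_pair.dim_quotient_le[of "f i" _ W _ W'])
    show "f i v \<in> tor_cycles ds' D' i j" if "v \<in> tor_cycles ds D i j" for v
    proof (cases i)
      case 0
      then show ?thesis using that f_ch by (simp add: tor_cycles_def)
    next
      case (Suc p)
      have "f p 0 = 0" unfolding f_def by (rule module_hom.zero[OF module_hom_mat_map])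
      then show ?thesis using that f_ch f_d by (simp add: Suc tor_cycles_def zero_fun_def)
    qed
    show "v \<in> tor_boundaries ds D i j" if vz: "v \<in> tor_cycles ds D i j" and vb: "f i v \<in> tor_boundaries ds' D' i j" for v
    proof -
      obtain u where u: "u \<in> tor_chains ds' (Suc i) j" "f i v = tor_diff ds' D' i u"
        using vb by (auto simp: tor_boundaries_def)
      then have "g i (f i v) \<in> tor_boundaries ds D i j"
        using g_d[OF u(1)] g_ch[OF u(1)] by (metis imageI tor_boundaries_def)
      from fun_vs.subspace_diff[OF F.subspace_tor_boundaries this gf[OF vz]] show ?thesis by simp
    qed
  qed (use W W' F.subspace_tor_cycles G.subspace_tor_cycles F.subspace_tor_boundaries G.subspace_tor_boundaries
      F.tor_boundaries_cycles G.tor_boundaries_cycles linear_mat_map in \<open>auto simp: f_def\<close>)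
qed

theorem tor_dim_unique:
  assumes "graded_free_resolution I ds D e" "graded_free_resolution I ds' D' e'" "hom_ideal I"
  shows "tor_dim ds D i j = tor_dim ds' D' i j"
proof -
  interpret P: graded_res_pair I ds D e ds' D' e' by unfold_locales fact+
  interpret Q: graded_res_pair I ds' D' e' ds D e ..
  show ?thesis using P.tor_dim_le Q.tor_dim_le by (rule antisym)
qed

text \<open>By uniqueness the choice in \<open>graded_betti\<close> has a single candidate, so any
  one resolution evaluates it.\<close>

corollary graded_betti_eq:
  assumes "graded_free_resolution I ds D e" "hom_ideal I"
  shows "graded_betti I i j = tor_dim ds D i j"
  unfolding graded_betti_def
  by (rule some_equality) (use assms tor_dim_unique in blast)+

section \<open>A Koszul-type complex of a simplicial complex\<close>

text \<open>The usual sign for deleting a from an exterior monomial. The variables carry no order,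
  so the numbering \<open>to_nat\<close> of the finite type provides one.\<close>

definition ksign :: "'n::finite \<Rightarrow> 'n set \<Rightarrow> 'a::comm_ring_1" where
  "ksign a F = (- 1) ^ card {b \<in> F. to_nat b < to_nat a}"

lemma ksign_mult_self [simp]: "ksign a F * (ksign a F * x) = x"
  by (simp add: ksign_def flip: mult.assoc power_add)

lemma ksign_insert_self [simp]: "ksign a (insert a F) = ksign a F"
proof -
  have "{b \<in> insert a F. to_nat b < to_nat a} = {b \<in> F. to_nat b < to_nat a}" by auto
  then show ?thesis by (simp add: ksign_def)
qed

lemma ksign_insert:
  assumes "b \<notin> F"
  shows "ksign a (insert b F) = (if to_nat b < to_nat a then - ksign a F else ksign a F)"
proof -
  have "{c \<in> insert b F. to_nat c < to_nat a} =
      (if to_nat b < to_nat a then insert b {c \<in> F. to_nat c < to_nat a} else {c \<in> F. to_nat c < to_nat a})"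
    by auto
  then show ?thesis using assms by (simp add: ksign_def)
qed

text \<open>Exactly one of the two elements precedes the other, so exactly one sign changes. This
  makes the differential square to zero; the variant \<open>ksign_swap'\<close> serves the
  contracting homotopies.\<close>

lemma ksign_swap:
  assumes "a \<noteq> b" "a \<notin> F" "b \<notin> F"
  shows "ksign a F * ksign b (insert a F) = - (ksign b F * ksign a (insert b F))"
proof -
  have "to_nat a < to_nat b \<longleftrightarrow> \<not> to_nat b < to_nat a" using assms(1)
    by (metis linorder_neqE_nat to_nat_split order_less_asym)
  then show ?thesis using assms by (auto simp: ksign_insert mult.commute)
qed

lemma ksign_swap':
  assumes "a \<noteq> b" "a \<notin> F" "b \<notin> F"
  shows "ksign a (insert b F) * ksign b (insert a F) = - (ksign a F * ksign b F)"
proof -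
  have "to_nat a < to_nat b \<longleftrightarrow> \<not> to_nat b < to_nat a" using assms(1)
    by (metis linorder_neqE_nat to_nat_split order_less_asym)
  then show ?thesis using assms by (auto simp: ksign_insert)
qed

lemma ksign_cases: "ksign a F = 1 \<or> ksign a F = - 1"
  unfolding ksign_def by (metis neg_one_even_power neg_one_odd_power)

text \<open>Here \<open>z\<close> is the vector of coordinates of a chain, so the terms of \<open>kmap \<Delta> w z (F, G)\<close> come from the basis
  elements mapped onto \<open>(F, G)\<close>. With \<open>w a = x\<^sub>a\<close> it is the differential of the resolution, with the
  indicator function of \<open>B\<close> that of the strand in any multidegree with support \<open>B\<close>, and with
  \<open>w = 0\<close> that of the resolution tensored with the residue field.\<close>

definition kmap :: "'n::finite set set \<Rightarrow> ('n \<Rightarrow> 'a::comm_ring_1) \<Rightarrow> ('n set \<times> 'n set \<Rightarrow> 'a) \<Rightarrow> 'n set \<times> 'n set \<Rightarrow> 'a" where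
  "kmap \<Delta> w z = (\<lambda>(F, G). if G \<in> \<Delta> then \<Sum>a\<in>-F. ksign a F *
     (if a \<in> G then - z (insert a F, G - {a}) else w a * z (insert a F, G)) else 0)"

definition kbasis :: "'n::finite set set \<Rightarrow> nat \<Rightarrow> ('n set \<times> 'n set) set" where
  "kbasis \<Delta> p = {(F, G). F \<inter> G = {} \<and> G \<in> \<Delta> \<and> card F = p}"

definition supp_in :: "('b \<Rightarrow> 'a::zero) \<Rightarrow> 'b set \<Rightarrow> bool" where
  "supp_in z S \<longleftrightarrow> (\<forall>x. x \<notin> S \<longrightarrow> z x = 0)"

definition down_closed :: "'n set set \<Rightarrow> bool" where
  "down_closed \<Delta> \<longleftrightarrow> (\<forall>A\<in>\<Delta>. \<forall>B\<subseteq>A. B \<in> \<Delta>)"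

lemma kmap_supp:
  assumes "supp_in z (kbasis \<Delta> (Suc p))"
  shows "supp_in (kmap \<Delta> w z) (kbasis \<Delta> p)"
proof -
  have "kmap \<Delta> w z (F, G) = 0" if "(F, G) \<notin> kbasis \<Delta> p" for F G
  proof (cases "G \<in> \<Delta>")
    case True
    have "z (insert a F, G - {a}) = 0 \<and> z (insert a F, G) = 0" if "a \<notin> F" for a
    proof -
      have "(insert a F, G - {a}) \<notin> kbasis \<Delta> (Suc p)" "(insert a F, G) \<notin> kbasis \<Delta> (Suc p)"
        using \<open>(F, G) \<notin> kbasis \<Delta> p\<close> that True by (auto simp: kbasis_def)
      then show ?thesis using assms by (simp add: supp_in_def)
    qed
    then show ?thesis by (auto simp: kmap_def intro!: sum.neutral)
  qed (simp add: kmap_def)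
  then show ?thesis by (auto simp: supp_in_def)
qed

text \<open>The terms for (a, b) and (b, a) cancel. Splitting the index set by the order of a and b
  avoids division by 2 and so covers characteristic 2.\<close>

lemma antisym_sum:
  fixes g :: "'n::finite \<Rightarrow> 'n \<Rightarrow> 'a::comm_ring_1"
  assumes "\<And>a b. a \<notin> F \<Longrightarrow> b \<notin> F \<Longrightarrow> a \<noteq> b \<Longrightarrow> g b a = - g a b"
  shows "(\<Sum>a\<in>-F. \<Sum>b\<in>-insert a F. g a b) = 0"
proof -
  define L where "L = {(a, b). a \<notin> F \<and> b \<notin> F \<and> to_nat a < to_nat b}"
  have "(\<Sum>a\<in>-F. \<Sum>b\<in>-insert a F. g a b) = (\<Sum>(a, b)\<in>Sigma (-F) (\<lambda>a. - insert a F). g a b)"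
    by (rule sum.Sigma) auto
  also have "Sigma (-F) (\<lambda>a. - insert a F) = L \<union> prod.swap ` L"
    by (auto simp: L_def image_iff) (metis linorder_neqE_nat inj_to_nat injD)
  also have "(\<Sum>(a, b)\<in>\<dots>. g a b) = (\<Sum>(a, b)\<in>L. g a b) + (\<Sum>(a, b)\<in>prod.swap ` L. g a b)"
    by (rule sum.union_disjoint) (auto simp: L_def)
  also have "(\<Sum>(a, b)\<in>prod.swap ` L. g a b) = (\<Sum>(a, b)\<in>L. g b a)"
    by (subst sum.reindex) (auto intro!: sum.cong)
  also have "\<dots> = (\<Sum>(a, b)\<in>L. - g a b)"
    using assms by (auto intro!: sum.cong simp: L_def)
  finally show ?thesis by (simp add: sum_negf case_prod_unfold)
qed

lemma kmap_kmap:
  assumes "down_closed \<Delta>"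
  shows "kmap \<Delta> w (kmap \<Delta> w z) = (\<lambda>_. 0)"
proof -
  have "kmap \<Delta> w (kmap \<Delta> w z) (F, G) = 0" if G: "G \<in> \<Delta>" for F G
  proof -
    \<comment> \<open>The weights of the two moves are collected in \<open>t\<close>, which is
      symmetric in a and b; the signs then make the summand antisymmetric.\<close>
    define t where "t = (\<lambda>a b. (if a \<in> G then - 1 else w a) * (if b \<in> G then - 1 else w b)
      * z (insert a (insert b F), G - {a, b}))"
    have tsym: "t b a = t a b" for a b by (simp add: t_def insert_commute mult.commute)
    have inner: "kmap \<Delta> w z (insert a F, if a \<in> G then G - {a} else G) * (if a \<in> G then - 1 else w a)
      = (\<Sum>b\<in>-insert a F. ksign b (insert a F) * t a b)" if "a \<notin> F" for a
    proof -
      \<comment> \<open>A face stays a face after removal of a, so the inner value is given by the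
        sum and not by the default 0.\<close>
      have G': "(if a \<in> G then G - {a} else G) = G - {a}" "G - {a} \<in> \<Delta>"
        using assms G by (auto simp: down_closed_def)
      have "ksign b (insert a F) * (if b \<in> G - {a} then - z (insert b (insert a F), G - {a} - {b})
          else w b * z (insert b (insert a F), G - {a})) * (if a \<in> G then - 1 else w a)
        = ksign b (insert a F) * t a b" if "b \<notin> insert a F" for b
      proof -
        have "G - {a} - {b} = G - {a, b}" by auto
        moreover have "G - {a} = G - {a, b}" if "b \<notin> G" using that by auto
        ultimately show ?thesis using that by (simp add: t_def insert_commute[of b a] algebra_simps)
      qed
      then show ?thesis unfolding G'(1) using G'(2) by (simp add: kmap_def sum_distrib_right del: Diff_iff insert_iff)
    qed
    have "kmap \<Delta> w (kmap \<Delta> w z) (F, G) = (\<Sum>a\<in>-F. ksign a F *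
        (kmap \<Delta> w z (insert a F, if a \<in> G then G - {a} else G) * (if a \<in> G then - 1 else w a)))"
      unfolding kmap_def[of \<Delta> w "kmap \<Delta> w z"] using G by (auto intro!: sum.cong)
    also have "\<dots> = (\<Sum>a\<in>-F. \<Sum>b\<in>-insert a F. ksign a F * ksign b (insert a F) * t a b)"
      by (rule sum.cong[OF refl]) (subst inner, simp_all add: sum_distrib_left mult.assoc)
    also have "\<dots> = 0"
    proof (rule antisym_sum)
      fix a b assume "a \<notin> F" "b \<notin> F" "a \<noteq> b"
      then show "ksign b F * ksign a (insert b F) * t b a = - (ksign a F * ksign b (insert a F) * t a b)"
        using ksign_swap[of b a F] tsym[of b a] by (metis mult_minus_left)
    qed
    finally show ?thesis .
  qed
  then show ?thesis by (auto simp: kmap_def fun_eq_iff)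
qed

lemma kmap_diff: "kmap \<Delta> w (\<lambda>x. y x - z x) x = kmap \<Delta> w y x - kmap \<Delta> w z x"
  by (cases x) (simp add: kmap_def flip: sum_subtractf, auto intro!: sum.cong simp: algebra_simps)

lemma kmap_sum:
  "kmap \<Delta> w (\<lambda>x. \<Sum>s\<in>S. u s x * c s) y = (\<Sum>s\<in>S. kmap \<Delta> w (u s) y * c s)"
proof (cases y)
  case (Pair F G)
  show ?thesis
  proof (cases "G \<in> \<Delta>")
    case True
    have "kmap \<Delta> w (\<lambda>x. \<Sum>s\<in>S. u s x * c s) y = (\<Sum>a\<in>-F. \<Sum>s\<in>S. ksign a F *
     (if a \<in> G then - u s (insert a F, G - {a}) else w a * u s (insert a F, G)) * c s)"
      unfolding Pair kmap_def using True
      by (auto simp: sum_distrib_left sum_negf[symmetric] mult.assoc intro!: sum.cong)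
    also have "\<dots> = (\<Sum>s\<in>S. kmap \<Delta> w (u s) y * c s)"
      by (subst sum.swap) (simp add: Pair kmap_def True sum_distrib_right)
    finally show ?thesis .
  qed (simp add: Pair kmap_def)
qed

section \<open>Strands of fixed support\<close>

definition inside :: "'n set \<Rightarrow> ('n set \<times> 'n set \<Rightarrow> 'a::zero) \<Rightarrow> bool" where
  "inside B z \<longleftrightarrow> (\<forall>F G. z (F, G) \<noteq> 0 \<longrightarrow> F \<union> G \<subseteq> B)"

abbreviation indic :: "'n set \<Rightarrow> 'n \<Rightarrow> 'a::comm_ring_1" where
  "indic B a \<equiv> of_bool (a \<in> B)"

lemma kmap_inside:
  assumes "inside B z"
  shows "inside B (kmap \<Delta> (indic B) z)"
proof -
  have "kmap \<Delta> (indic B) z (F, G) = 0" if "\<not> F \<union> G \<subseteq> B" for F G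
  proof -
    have "z (insert a F, G - {a}) = 0" if "a \<in> G" for a
      using assms \<open>\<not> F \<union> G \<subseteq> B\<close> that unfolding inside_def by blast
    moreover have "z (insert a F, G) = 0" for a
      using assms \<open>\<not> F \<union> G \<subseteq> B\<close> unfolding inside_def by blast
    ultimately show ?thesis by (auto simp: kmap_def intro!: sum.neutral)
  qed
  then show ?thesis unfolding inside_def by blast
qed

lemma kmap_zero: "kmap \<Delta> w (\<lambda>_. 0) = (\<lambda>_. 0)"
  by (auto simp: kmap_def fun_eq_iff cong: if_cong)

text \<open>The terms of the differential keeping \<open>G\<close> form a Koszul complex on the complement of \<open>G\<close> in \<open>B\<close>,
  contracted by multiplication with any fixed \<open>c G\<close> in this complement. The other terms raise
  \<open>|G|\<close>, so correcting the part with minimal \<open>|G|\<close> makes progress.\<close>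

lemma strand_step:
  fixes z :: "'n::finite set \<times> 'n set \<Rightarrow> 'a::comm_ring_1"
  assumes z: "supp_in z (kbasis \<Delta> p)" "inside B z"
    and cyc: "p > 0 \<Longrightarrow> kmap \<Delta> (indic B) z = (\<lambda>_. 0)"
    and low: "\<And>F G. z (F, G) \<noteq> 0 \<Longrightarrow> m \<le> card G \<or> G = B"
  shows "\<exists>y. supp_in y (kbasis \<Delta> (Suc p)) \<and> inside B y \<and>
    (\<forall>F G. z (F, G) - kmap \<Delta> (indic B) y (F, G) \<noteq> 0 \<longrightarrow> Suc m \<le> card G \<or> G = B)"
proof -
  define c where "c = (\<lambda>G. SOME a. a \<in> B - G)"
  define y where "y = (\<lambda>(F, G). if card G = m \<and> G \<subset> B \<and> c G \<in> F then ksign (c G) F * z (F - {c G}, G) else 0)"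
  have c: "c G \<in> B" "c G \<notin> G" if "G \<subset> B" for G
    using someI_ex[of "\<lambda>a. a \<in> B - G"] that unfolding c_def by auto
  have "y (F, G) = 0" if "(F, G) \<notin> kbasis \<Delta> (Suc p)" for F G
  proof (cases "card G = m \<and> G \<subset> B \<and> c G \<in> F")
    case True
    then have "(F - {c G}, G) \<notin> kbasis \<Delta> p"
      using that c[of G] card_Suc_Diff1[of F "c G"] by (auto simp: kbasis_def)
    then show ?thesis using z(1) by (simp add: y_def supp_in_def)
  qed (auto simp: y_def)
  then have y1: "supp_in y (kbasis \<Delta> (Suc p))" by (auto simp: supp_in_def)
  have "F \<union> G \<subseteq> B" if "y (F, G) \<noteq> 0" for F G
  proof -
    have "z (F - {c G}, G) \<noteq> 0" "G \<subset> B" using that by (auto simp: y_def split: if_splits)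
    then show ?thesis using z(2) c[of G] unfolding inside_def by blast
  qed
  then have y2: "inside B y" by (auto simp: inside_def)
  have "kmap \<Delta> (indic B) y (F, G) = z (F, G)" if "card G \<le> m" "G \<noteq> B" for F G
  proof (cases "(F, G) \<in> kbasis \<Delta> p \<and> F \<union> G \<subseteq> B \<and> card G = m")
    case False
    have "z (F, G) = 0"
      using False z that low[of F G] unfolding supp_in_def inside_def by (metis le_antisym)
    moreover have "kmap \<Delta> (indic B) y (F, G) = 0"
    proof (cases "card G < m")
      case True
      then have "y (insert a F, G - {a}) = 0 \<and> y (insert a F, G) = 0" for a
        using card_Diff1_le[of G a] by (auto simp: y_def)
      then show ?thesis by (auto simp: kmap_def intro!: sum.neutral)
    next
      case card: False
      then have "\<not> ((F, G) \<in> kbasis \<Delta> p \<and> F \<union> G \<subseteq> B)" using False that by auto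
      then show ?thesis
        using kmap_supp[OF y1, of "indic B"] kmap_inside[OF y2, of \<Delta>] unfolding supp_in_def inside_def by metis
    qed
    ultimately show ?thesis by simp
  next
    case True
    then have FG: "F \<inter> G = {}" "G \<in> \<Delta>" "card F = p" "F \<subseteq> B" "G \<subset> B" "card G = m"
      using that by (auto simp: kbasis_def)
    define a where "a = c G"
    have a: "a \<in> B" "a \<notin> G" using c[of G] FG by (auto simp: a_def)
    have yG: "y (F', G) = (if a \<in> F' then ksign a F' * z (F' - {a}, G) else 0)" for F'
      using FG by (simp add: y_def a_def)
    \<comment> \<open>Elements of G would lead to pairs with a smaller second component, where
      \<open>y\<close> is zero by construction and \<open>z\<close> by the bound
      \<open>low\<close>.\<close>
    have low_y: "y (F', G - {b}) = 0" if "b \<in> G" for F' b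
      using that FG card_Suc_Diff1[of G b] by (auto simp: y_def)
    have low_z: "z (F', G - {b}) = 0" if "b \<in> G" for F' b
      using that FG card_Suc_Diff1[of G b] low[of F' "G - {b}"] by auto
    have kdy: "kmap \<Delta> (indic B) y (F, G) = (\<Sum>b\<in>-(F \<union> G). ksign b F * (indic B b * y (insert b F, G)))"
      unfolding kmap_def using FG low_y by (auto intro!: sum.mono_neutral_cong_right)
    show ?thesis
    proof (cases "a \<in> F")
      case False
      \<comment> \<open>Only b = a brings the chosen element \<open>c G\<close> into the first
        component.\<close>
      have "y (insert b F, G) = (if b = a then ksign a F * z (F, G) else 0)" if "b \<notin> F" for b
        using False that by (auto simp: yG)
      then have "ksign b F * (indic B b * y (insert b F, G)) = (if b = a then z (F, G) else 0)" if "b \<notin> F" for b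
        using a that by simp
      then have "kmap \<Delta> (indic B) y (F, G) = (\<Sum>b\<in>-(F \<union> G). if b = a then z (F, G) else 0)"
        unfolding kdy by (intro sum.cong[OF refl]) auto
      then show ?thesis using False a by simp
    next
      case True
      \<comment> \<open>The cycle condition is evaluated at F without a. It expresses the
        coefficient of \<open>z\<close> at (F, G) through the terms with b \<noteq> a, and up to a
        common sign these are the terms of the differential of \<open>y\<close>.\<close>
      define F0 where "F0 = F - {a}"
      have F0: "F = insert a F0" "a \<notin> F0" using True by (auto simp: F0_def)
      have "p > 0" using True FG by (auto simp: card_gt_0_iff)
      have "0 = kmap \<Delta> (indic B) z (F0, G)" using cyc[OF \<open>p > 0\<close>] by simp
      also have "\<dots> = (\<Sum>b\<in>-(F0 \<union> G). ksign b F0 * (indic B b * z (insert b F0, G)))"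
        unfolding kmap_def using FG low_z by (auto intro!: sum.mono_neutral_cong_right)
      also have "-(F0 \<union> G) = insert a (-(F \<union> G))" using F0 a by auto
      also have "(\<Sum>b\<in>\<dots>. ksign b F0 * (indic B b * z (insert b F0, G))) =
          ksign a F0 * z (F, G) + (\<Sum>b\<in>-(F \<union> G). ksign b F0 * (indic B b * z (insert b F0, G)))"
        using F0 a by (subst sum.insert) auto
      finally have s: "(\<Sum>b\<in>-(F \<union> G). ksign b F0 * (indic B b * z (insert b F0, G))) = - (ksign a F0 * z (F, G))"
        by (simp add: eq_neg_iff_add_eq_0 add.commute)
      have "ksign b F * (indic B b * y (insert b F, G)) = - (ksign a F0 * (ksign b F0 * (indic B b * z (insert b F0, G))))"
        if "b \<notin> F" for b
      proof -
        have *: "insert b F - {a} = insert b F0" using that F0 by auto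
        have "y (insert b F, G) = ksign a (insert b F0) * z (insert b F0, G)"
          unfolding yG * by (simp add: F0(1) insert_commute[of b a])
        then have "ksign b F * (indic B b * y (insert b F, G))
            = (ksign b (insert a F0) * ksign a (insert b F0)) * (indic B b * z (insert b F0, G))"
          by (simp add: F0(1) algebra_simps)
        also have "ksign b (insert a F0) * ksign a (insert b F0) = - (ksign b F0 * ksign a F0 :: 'a)"
          using that F0 by (intro ksign_swap') auto
        finally show ?thesis by (simp add: algebra_simps)
      qed
      then have "kmap \<Delta> (indic B) y (F, G) =
          (\<Sum>b\<in>-(F \<union> G). - (ksign a F0 * (ksign b F0 * (indic B b * z (insert b F0, G)))))"
        unfolding kdy by (intro sum.cong) auto
      then show ?thesis
        by (simp only: sum_negf sum_distrib_left[symmetric] s mult_minus_right ksign_mult_self minus_minus)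
    qed
  qed
  then show ?thesis using y1 y2 by (intro exI[of _ y]) (metis diff_self not_less_eq_eq)
qed

lemma kmap_add: "kmap \<Delta> w (\<lambda>x. y x + z x) x = kmap \<Delta> w y x + kmap \<Delta> w z x"
  by (cases x) (simp add: kmap_def flip: sum.distrib, auto intro!: sum.cong simp: algebra_simps)

lemma supp_in_diff: "supp_in y S \<Longrightarrow> supp_in z S \<Longrightarrow> supp_in (\<lambda>x. y x - z x) S"
  for y z :: "_ \<Rightarrow> 'a::comm_ring_1"
  by (simp add: supp_in_def)

lemma supp_in_add: "supp_in y S \<Longrightarrow> supp_in z S \<Longrightarrow> supp_in (\<lambda>x. y x + z x) S"
  for y z :: "_ \<Rightarrow> 'a::comm_ring_1"
  by (simp add: supp_in_def)

lemma inside_diff: "inside B y \<Longrightarrow> inside B z \<Longrightarrow> inside B (\<lambda>x. y x - z x)"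
  for y z :: "_ \<Rightarrow> 'a::comm_ring_1"
  unfolding inside_def by (metis diff_self)

lemma inside_add: "inside B y \<Longrightarrow> inside B z \<Longrightarrow> inside B (\<lambda>x. y x + z x)"
  for y z :: "_ \<Rightarrow> 'a::comm_ring_1"
  unfolding inside_def by (metis add.right_neutral)

text \<open>Each correction leaves a cycle because the differential squares to zero, so
  \<open>strand_step\<close> can be iterated.\<close>

lemma strand_reduce:
  fixes z :: "'n::finite set \<times> 'n set \<Rightarrow> 'a::comm_ring_1"
  assumes \<Delta>: "down_closed \<Delta>" and z: "supp_in z (kbasis \<Delta> p)" "inside B z"
    and cyc: "p > 0 \<Longrightarrow> kmap \<Delta> (indic B) z = (\<lambda>_. 0)"
  shows "\<exists>y. supp_in y (kbasis \<Delta> (Suc p)) \<and> inside B y \<and>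
    (\<forall>F G. z (F, G) - kmap \<Delta> (indic B) y (F, G) \<noteq> 0 \<longrightarrow> m \<le> card G \<or> G = B)"
proof (induction m)
  case 0
  show ?case by (intro exI[of _ "\<lambda>_. 0"]) (simp add: supp_in_def inside_def)
next
  case (Suc m)
  then obtain y where y: "supp_in y (kbasis \<Delta> (Suc p))" "inside B y"
    "\<And>F G. z (F, G) - kmap \<Delta> (indic B) y (F, G) \<noteq> 0 \<Longrightarrow> m \<le> card G \<or> G = B" by blast
  define z' where "z' = (\<lambda>x. z x - kmap \<Delta> (indic B) y x)"
  have z': "supp_in z' (kbasis \<Delta> p)" "inside B z'"
    unfolding z'_def
    by (rule supp_in_diff[OF z(1) kmap_supp[OF y(1)]], rule inside_diff[OF z(2) kmap_inside[OF y(2)]])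
  have "kmap \<Delta> (indic B) z' = (\<lambda>_. 0)" if "p > 0"
    unfolding z'_def using kmap_diff[of \<Delta> "indic B" z "kmap \<Delta> (indic B) y"] cyc[OF that] kmap_kmap[OF \<Delta>, of "indic B" y]
    by (simp add: fun_eq_iff)
  then obtain y' where y': "supp_in y' (kbasis \<Delta> (Suc p))" "inside B y'"
    "\<And>F G. z' (F, G) - kmap \<Delta> (indic B) y' (F, G) \<noteq> 0 \<Longrightarrow> Suc m \<le> card G \<or> G = B"
    using strand_step[OF z', of m] y(3) unfolding z'_def by blast
  have "z x - kmap \<Delta> (indic B) (\<lambda>x. y x + y' x) x = z' x - kmap \<Delta> (indic B) y' x" for x
    by (simp add: z'_def kmap_add)
  then show ?case using y y'
    by (intro exI[of _ "\<lambda>x. y x + y' x"]) (simp add: supp_in_add inside_add)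
qed

text \<open>In the strand of support B the augmentation adds up the coefficients at ({}, G). For G
  without a, the coefficient of \<open>y\<close> at ({a}, G) enters once at G and once, with
  opposite sign, at G + a.\<close>

lemma strand_aug:
  fixes y :: "'n::finite set \<times> 'n set \<Rightarrow> 'a::comm_ring_1"
  assumes \<Delta>: "down_closed \<Delta>" and y: "supp_in y (kbasis \<Delta> 1)" "inside B y" and B: "B \<in> \<Delta>"
  shows "(\<Sum>G\<in>Pow B. kmap \<Delta> (indic B) y ({}, G)) = 0"
proof -
  have "(\<Sum>G\<in>Pow B. kmap \<Delta> (indic B) y ({}, G)) =
      (\<Sum>G\<in>Pow B. \<Sum>a\<in>UNIV. if a \<in> G then - y ({a}, G - {a}) else y ({a}, G))"
  proof (rule sum.cong[OF refl])
    fix G assume "G \<in> Pow B"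
    then have "G \<in> \<Delta>" using \<Delta> B by (auto simp: down_closed_def)
    moreover have "y ({a}, G) = 0" if "a \<notin> B" for a using y(2) that unfolding inside_def by blast
    ultimately show "kmap \<Delta> (indic B) y ({}, G) = (\<Sum>a\<in>UNIV. if a \<in> G then - y ({a}, G - {a}) else y ({a}, G))"
      by (auto simp: kmap_def ksign_def intro!: sum.cong)
  qed
  also have "\<dots> = (\<Sum>a\<in>UNIV. \<Sum>G\<in>Pow B. if a \<in> G then - y ({a}, G - {a}) else y ({a}, G))"
    by (rule sum.swap)
  also have "\<dots> = 0"
  proof (rule sum.neutral, rule ballI)
    fix a
    show "(\<Sum>G\<in>Pow B. if a \<in> G then - y ({a}, G - {a}) else y ({a}, G)) = 0"
    proof (cases "a \<in> B")
      case False
      then have "y ({a}, G) = 0" for G using y(2) unfolding inside_def by blast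
      then show ?thesis by (auto intro!: sum.neutral)
    next
      case True
      define S where "S = Pow (B - {a})"
      have "Pow B = S \<union> insert a ` S"
        using True Pow_insert[of a "B - {a}"] by (simp add: S_def insert_absorb)
      moreover have "S \<inter> insert a ` S = {}" "inj_on (insert a) S" "\<And>G. G \<in> S \<Longrightarrow> a \<notin> G"
        by (auto simp: S_def inj_on_def)
      ultimately show ?thesis by (auto simp: sum.union_disjoint sum.reindex sum_negf[symmetric] sum.distrib[symmetric] intro!: sum.neutral)
    qed
  qed
  finally show ?thesis .
qed

lemma strand_exact:
  fixes z :: "'n::finite set \<times> 'n set \<Rightarrow> 'a::comm_ring_1"
  assumes \<Delta>: "down_closed \<Delta>" and z: "supp_in z (kbasis \<Delta> p)" "inside B z"
    and cyc: "p > 0 \<Longrightarrow> kmap \<Delta> (indic B) z = (\<lambda>_. 0)"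
    and aug: "p = 0 \<Longrightarrow> B \<in> \<Delta> \<Longrightarrow> (\<Sum>G\<in>Pow B. z ({}, G)) = 0"
  shows "\<exists>y. supp_in y (kbasis \<Delta> (Suc p)) \<and> inside B y \<and> kmap \<Delta> (indic B) y = z"
proof -
  \<comment> \<open>The bound n + 1 exceeds the size of every G, so only G = B survives.\<close>
  obtain y where y: "supp_in y (kbasis \<Delta> (Suc p))" "inside B y"
    "\<And>F G. z (F, G) - kmap \<Delta> (indic B) y (F, G) \<noteq> 0 \<Longrightarrow> Suc (card (UNIV :: 'n set)) \<le> card G \<or> G = B"
    using strand_reduce[OF \<Delta> z cyc] by blast
  define z' where "z' = (\<lambda>x. z x - kmap \<Delta> (indic B) y x)"
  have z'B: "z' (F, G) = 0" if "G \<noteq> B" for F G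
    using y(3)[of F G] that card_mono[of UNIV G] unfolding z'_def by (metis finite not_less_eq_eq subset_UNIV)
  have z': "supp_in z' (kbasis \<Delta> p)" "inside B z'"
    unfolding z'_def
    by (rule supp_in_diff[OF z(1) kmap_supp[OF y(1)]], rule inside_diff[OF z(2) kmap_inside[OF y(2)]])
  have z'F: "z' (F, B) = 0" if "F \<noteq> {}" for F
  proof (rule ccontr)
    assume "z' (F, B) \<noteq> 0"
    then have "F \<subseteq> B" "(F, B) \<in> kbasis \<Delta> p" using z' by (auto simp: supp_in_def inside_def)
    then show False using that by (auto simp: kbasis_def)
  qed
  \<comment> \<open>Disjointness has left only the pair ({}, B). It lives in homological degree 0,
    where the vanishing augmentation determines its coefficient.\<close>
  have "z' ({}, B) = 0"
  proof (cases "p = 0 \<and> B \<in> \<Delta>")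
    case True
    have "(\<Sum>G\<in>Pow B. z' ({}, G)) = 0"
      using aug strand_aug[of \<Delta> y B] \<Delta> y True by (simp add: z'_def sum_subtractf)
    moreover have "(\<Sum>G\<in>Pow B. z' ({}, G)) = (\<Sum>G\<in>{B}. z' ({}, G))"
      by (rule sum.mono_neutral_right) (auto simp: z'B)
    ultimately show ?thesis by simp
  next
    case False
    then show ?thesis using z'(1) by (auto simp: supp_in_def kbasis_def)
  qed
  then have "z' x = 0" for x using z'B z'F by (cases x) metis
  then show ?thesis using y by (intro exI[of _ y]) (auto simp: z'_def fun_eq_iff)
qed

section \<open>Exactness over the polynomial ring\<close>

lift_definition sqf :: "'n::finite set \<Rightarrow> 'n \<Rightarrow>\<^sub>0 nat" is "\<lambda>A x. if x \<in> A then 1 else 0"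
  by simp

lemma lookup_sqf: "Poly_Mapping.lookup (sqf A) x = (if x \<in> A then 1 else 0)"
  by transfer rule

lemma keys_sqf [simp]: "Poly_Mapping.keys (sqf A) = A"
  by (auto simp: in_keys_iff lookup_sqf split: if_splits)

lemma mdeg_sqf [simp]: "mdeg (sqf A) = card A"
  by (simp add: mdeg_def lookup_sqf sum.If_cases)

lemma squarefree_mon_sqf: "squarefree_mon (sqf A)"
  by (simp add: squarefree_mon_def lookup_sqf)

lemma sqf_keys: "squarefree_mon u \<Longrightarrow> sqf (Poly_Mapping.keys u) = u"
  by (rule poly_mapping_eqI) (auto simp: lookup_sqf squarefree_mon_def in_keys_iff intro!: le_antisym Suc_leI)

lemma keys_add_nat: "Poly_Mapping.keys (a + b) = Poly_Mapping.keys a \<union> Poly_Mapping.keys (b :: 'n \<Rightarrow>\<^sub>0 nat)"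
  by (auto simp: in_keys_iff lookup_add)

lemma lookup_monomial_mult:
  fixes f :: "('n::finite, 'k::field) mpoly"
  shows "Poly_Mapping.lookup (monomial m * f) b =
    (if \<forall>x. Poly_Mapping.lookup m x \<le> Poly_Mapping.lookup b x then Poly_Mapping.lookup f (b - m) else 0)"
proof -
  have eq: "(b = m + q) \<longleftrightarrow> q = b - m \<and> (\<forall>x. Poly_Mapping.lookup m x \<le> Poly_Mapping.lookup b x)" for q
    by (auto simp: poly_mapping_eq_iff lookup_add lookup_minus fun_eq_iff)
  have "Poly_Mapping.lookup (monomial m * f) b = Sum_any (\<lambda>q. Poly_Mapping.lookup f q when b = m + q)"
    by (simp add: monomial_def lookup_mult lookup_single when_mult)
  then show ?thesis by (cases "\<forall>x. Poly_Mapping.lookup m x \<le> Poly_Mapping.lookup b x") (auto simp: eq)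
qed

lemma lookup_ksign_mult: "Poly_Mapping.lookup (ksign a F * f) m = ksign a F * Poly_Mapping.lookup f m"
  for f :: "('n::finite, 'k::field) mpoly"
proof -
  have "Poly_Mapping.lookup ((- 1) ^ n * f) m = (- 1) ^ n * Poly_Mapping.lookup f m" for n
    by (induction n) (simp_all add: mult.assoc)
  then show ?thesis by (simp add: ksign_def)
qed

definition sr_ideal :: "'n::finite set set \<Rightarrow> ('n, 'k::field) mpoly set" where
  "sr_ideal \<Delta> = {f. \<forall>m\<in>Poly_Mapping.keys f. Poly_Mapping.keys m \<notin> \<Delta>}"

lemma hom_ideal_sr_ideal:
  assumes "down_closed \<Delta>"
  shows "hom_ideal (sr_ideal \<Delta> :: ('n::finite, 'k::field) mpoly set)"
proof -
  have "f + g \<in> sr_ideal \<Delta>" if "f \<in> sr_ideal \<Delta>" "g \<in> sr_ideal \<Delta>" for f g :: "('n, 'k) mpoly"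
    using that keys_add[of f g] by (auto simp: sr_ideal_def)
  moreover have "f * g \<in> sr_ideal \<Delta>" if "g \<in> sr_ideal \<Delta>" for f g :: "('n, 'k) mpoly"
  proof -
    have "Poly_Mapping.keys m \<notin> \<Delta>" if m: "m \<in> Poly_Mapping.keys (f * g)" for m
    proof -
      obtain a b where "m = a + b" "b \<in> Poly_Mapping.keys g" using m keys_mult[of f g] by blast
      then have "Poly_Mapping.keys b \<notin> \<Delta>" "Poly_Mapping.keys b \<subseteq> Poly_Mapping.keys m"
        using \<open>g \<in> sr_ideal \<Delta>\<close> by (auto simp: sr_ideal_def keys_add_nat)
      then show ?thesis using assms by (auto simp: down_closed_def)
    qed
    then show ?thesis by (simp add: sr_ideal_def)
  qed
  moreover have "0 \<in> (sr_ideal \<Delta> :: ('n, 'k) mpoly set)"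
    by (simp add: sr_ideal_def)
  moreover have "hcomp d f \<in> sr_ideal \<Delta>" if "f \<in> sr_ideal \<Delta>" for d and f :: "('n, 'k) mpoly"
    using that by (simp add: sr_ideal_def keys_hcomp)
  ultimately show ?thesis
    by (simp add: hom_ideal_def module.subspace_def[OF module_times])
qed

text \<open>The monomial \<open>m\<close> times the basis element \<open>(F, G)\<close> has multidegree \<open>m + sqf (F \<union> G)\<close>. The side condition
  is needed because subtraction of exponents is truncated.\<close>

definition strand :: "('n::finite \<Rightarrow>\<^sub>0 nat) \<Rightarrow> ('n set \<times> 'n set \<Rightarrow> ('n, 'k::field) mpoly) \<Rightarrow> 'n set \<times> 'n set \<Rightarrow> 'k" where
  "strand b z = (\<lambda>(F, G). if F \<union> G \<subseteq> Poly_Mapping.keys b then Poly_Mapping.lookup (z (F, G)) (b - sqf (F \<union> G)) else 0)"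

abbreviation pvar :: "'n::finite \<Rightarrow> ('n, 'k::field) mpoly" where
  "pvar a \<equiv> monomial (sqf {a})"

lemma strand_supp: "supp_in z S \<Longrightarrow> supp_in (strand b z) S"
  by (auto simp: supp_in_def strand_def)

lemma strand_inside: "inside (Poly_Mapping.keys b) (strand b z)"
  by (auto simp: inside_def strand_def)

text \<open>For a outside F \<union> G, multiplication by x_a only shifts exponents: in multidegree
  b it preserves the coefficient if x_a divides b and contributes nothing otherwise. Hence the
  weight becomes the indicator of the support of b.\<close>

lemma strand_kmap:
  assumes z: "supp_in z (kbasis \<Delta> (Suc p))"
  shows "strand b (kmap \<Delta> pvar z) = kmap \<Delta> (indic (Poly_Mapping.keys b)) (strand b z)"
proof -
  let ?B = "Poly_Mapping.keys b"
  have "strand b (kmap \<Delta> pvar z) (F, G) = kmap \<Delta> (indic ?B) (strand b z) (F, G)" for F G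
  proof (cases "F \<union> G \<subseteq> ?B \<and> (F, G) \<in> kbasis \<Delta> p")
    case False
    then have "strand b (kmap \<Delta> pvar z) (F, G) = 0"
      using strand_inside[of b "kmap \<Delta> pvar z"] strand_supp[OF kmap_supp[OF z, of pvar], of b]
      unfolding inside_def supp_in_def by metis
    moreover have "kmap \<Delta> (indic ?B) (strand b z) (F, G) = 0"
      using False kmap_inside[OF strand_inside[of b z], of \<Delta>] kmap_supp[OF strand_supp[OF z, of b], of "indic ?B"]
      unfolding inside_def supp_in_def by metis
    ultimately show ?thesis by simp
  next
    case True
    then have FG: "F \<inter> G = {}" "G \<in> \<Delta>" "F \<union> G \<subseteq> ?B" by (auto simp: kbasis_def)
    let ?m = "b - sqf (F \<union> G)"
    have "Poly_Mapping.lookup (if a \<in> G then - z (insert a F, G - {a}) else pvar a * z (insert a F, G)) ?m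
      = (if a \<in> G then - strand b z (insert a F, G - {a}) else indic ?B a * strand b z (insert a F, G))"
      if "a \<notin> F" for a
    proof (cases "a \<in> G")
      case True
      then have "insert a F \<union> (G - {a}) = F \<union> G" by auto
      then show ?thesis using True by (simp only: strand_def prod.case FG if_True lookup_uminus)
    next
      case aG: False
      have "(\<forall>x. Poly_Mapping.lookup (sqf {a}) x \<le> Poly_Mapping.lookup ?m x) \<longleftrightarrow> a \<in> ?B"
        using that aG by (auto simp: lookup_sqf lookup_minus in_keys_iff)
      moreover have "?m - sqf {a} = b - sqf (insert a F \<union> G)"
        using that aG by (intro poly_mapping_eqI) (auto simp: lookup_sqf lookup_minus)
      ultimately show ?thesis using aG FG by (simp add: strand_def lookup_monomial_mult)
    qed
    then show ?thesis using FG
      by (simp add: strand_def kmap_def lookup_sum lookup_ksign_mult cong: if_cong)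
  qed
  then show ?thesis by (simp add: fun_eq_iff)
qed

lemma strand_eqI:
  assumes "supp_in y (kbasis \<Delta> p)" "supp_in z (kbasis \<Delta> p)" "\<And>b. strand b y = strand b z"
  shows "y = z"
proof -
  have "y (F, G) = z (F, G)" for F G
  proof (rule poly_mapping_eqI)
    fix m
    have "strand (m + sqf (F \<union> G)) y (F, G) = strand (m + sqf (F \<union> G)) z (F, G)" by (simp add: assms(3))
    then show "Poly_Mapping.lookup (y (F, G)) m = Poly_Mapping.lookup (z (F, G)) m"
      by (auto simp: strand_def keys_add_nat split: if_splits)
  qed
  then show ?thesis by (simp add: fun_eq_iff)
qed

text \<open>Finiteness allows preimages chosen in separate multidegrees to be put together as
  polynomials.\<close>

lemma finite_strands: "finite {b. strand b z \<noteq> (\<lambda>_. 0)}"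
proof (rule finite_subset)
  show "finite (\<Union>(F, G)\<in>UNIV. (\<lambda>m. m + sqf (F \<union> G)) ` Poly_Mapping.keys (z (F, G)))" by auto
  show "{b. strand b z \<noteq> (\<lambda>_. 0)} \<subseteq> (\<Union>(F, G)\<in>UNIV. (\<lambda>m. m + sqf (F \<union> G)) ` Poly_Mapping.keys (z (F, G)))"
  proof
    fix b assume "b \<in> {b. strand b z \<noteq> (\<lambda>_. 0)}"
    then obtain F G where "strand b z (F, G) \<noteq> 0" by (auto simp: fun_eq_iff)
    then have FG: "F \<union> G \<subseteq> Poly_Mapping.keys b" "b - sqf (F \<union> G) \<in> Poly_Mapping.keys (z (F, G))"
      by (auto simp: strand_def in_keys_iff split: if_splits)
    then have "b = b - sqf (F \<union> G) + sqf (F \<union> G)"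
      by (intro poly_mapping_eqI) (auto simp: lookup_add lookup_minus lookup_sqf in_keys_iff Suc_le_eq)
    then show "b \<in> (\<Union>(F, G)\<in>UNIV. (\<lambda>m. m + sqf (F \<union> G)) ` Poly_Mapping.keys (z (F, G)))"
      using FG(2) by blast
  qed
qed

lemma assemble_strands:
  fixes y :: "('n::finite \<Rightarrow>\<^sub>0 nat) \<Rightarrow> 'n set \<times> 'n set \<Rightarrow> 'k::field"
  assumes fin: "finite {b. y b \<noteq> (\<lambda>_. 0)}"
    and y: "\<And>b. supp_in (y b) S" "\<And>b. inside (Poly_Mapping.keys b) (y b)"
  shows "\<exists>z. supp_in z S \<and> (\<forall>b. strand b z = y b)"
proof -
  define z where "z = (\<lambda>x. Poly_Mapping.Abs_poly_mapping (\<lambda>m. y (m + sqf (fst x \<union> snd x)) x))"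
  have z: "Poly_Mapping.lookup (z x) m = y (m + sqf (fst x \<union> snd x)) x" for x m
  proof -
    \<comment> \<open>For a fixed basis element distinct exponents m lie in distinct multidegrees,
      so each coordinate has finite support.\<close>
    have "(\<lambda>m. m + sqf (fst x \<union> snd x)) ` {m. y (m + sqf (fst x \<union> snd x)) x \<noteq> 0} \<subseteq> {b. y b \<noteq> (\<lambda>_. 0)}"
      by (auto simp del: split_paired_Ex split_paired_All simp: fun_eq_iff)
    then have "finite ((\<lambda>m. m + sqf (fst x \<union> snd x)) ` {m. y (m + sqf (fst x \<union> snd x)) x \<noteq> 0})"
      using fin finite_subset by blast
    then have "finite {m. y (m + sqf (fst x \<union> snd x)) x \<noteq> 0}"
      by (rule finite_imageD) (simp add: inj_on_def)
    then show ?thesis by (simp add: z_def)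
  qed
  have "supp_in z S" using y(1) unfolding supp_in_def
    by (auto intro!: poly_mapping_eqI simp: z)
  moreover have "strand b z (F, G) = y b (F, G)" for b F G
  proof (cases "F \<union> G \<subseteq> Poly_Mapping.keys b")
    case True
    then have "b - sqf (F \<union> G) + sqf (F \<union> G) = b"
      by (intro poly_mapping_eqI) (auto simp: lookup_add lookup_minus lookup_sqf in_keys_iff Suc_le_eq)
    then show ?thesis using True by (simp add: strand_def z)
  next
    case False
    then have "y b (F, G) = 0" using y(2)[of b] unfolding inside_def by blast
    then show ?thesis using False by (auto simp: strand_def)
  qed
  ultimately show ?thesis by (intro exI[of _ z]) (simp add: fun_eq_iff)
qed

text \<open>The augmentation sends ({}, G) to x^G. Then x_a ({}, G) and ({}, G + a) have the same
  image, and if G + a is not a face, that image lies in the ideal.\<close>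

definition kaug :: "'n::finite set set \<Rightarrow> ('n set \<times> 'n set \<Rightarrow> ('n, 'k::field) mpoly) \<Rightarrow> ('n, 'k) mpoly" where
  "kaug \<Delta> z = (\<Sum>G\<in>\<Delta>. monomial (sqf G) * z ({}, G))"

lemma lookup_kaug:
  assumes "down_closed \<Delta>" "Poly_Mapping.keys b \<in> \<Delta>"
  shows "Poly_Mapping.lookup (kaug \<Delta> z) b = (\<Sum>G\<in>Pow (Poly_Mapping.keys b). strand b z ({}, G))"
proof -
  have "(\<forall>x. Poly_Mapping.lookup (sqf G) x \<le> Poly_Mapping.lookup b x) \<longleftrightarrow> G \<subseteq> Poly_Mapping.keys b" for G
    by (auto simp: lookup_sqf in_keys_iff Suc_le_eq)
  then have "Poly_Mapping.lookup (kaug \<Delta> z) b = (\<Sum>G\<in>\<Delta>. strand b z ({}, G))"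
    by (simp add: kaug_def lookup_sum lookup_monomial_mult strand_def cong: if_cong)
  also have "\<dots> = (\<Sum>G\<in>Pow (Poly_Mapping.keys b). strand b z ({}, G))"
    using assms by (intro sum.mono_neutral_right) (auto simp: down_closed_def strand_def)
  finally show ?thesis .
qed

lemma kaug_kmap:
  assumes "down_closed \<Delta>" "supp_in y (kbasis \<Delta> 1)"
  shows "kaug \<Delta> (kmap \<Delta> pvar y) \<in> sr_ideal \<Delta>"
proof -
  have "Poly_Mapping.lookup (kaug \<Delta> (kmap \<Delta> pvar y)) b = 0" if "Poly_Mapping.keys b \<in> \<Delta>" for b
    using lookup_kaug[OF assms(1) that, of "kmap \<Delta> pvar y"] strand_kmap[of y \<Delta> 0 b] assms(2)
      strand_aug[OF assms(1) strand_supp[OF assms(2)] strand_inside that]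
    by simp
  then show ?thesis by (auto simp: sr_ideal_def in_keys_iff)
qed

lemma kmap_exact:
  fixes z :: "'n::finite set \<times> 'n set \<Rightarrow> ('n, 'k::field) mpoly"
  assumes \<Delta>: "down_closed \<Delta>" and z: "supp_in z (kbasis \<Delta> p)"
    and cyc: "p > 0 \<Longrightarrow> kmap \<Delta> pvar z = (\<lambda>_. 0)" and aug: "p = 0 \<Longrightarrow> kaug \<Delta> z \<in> sr_ideal \<Delta>"
  shows "\<exists>y. supp_in y (kbasis \<Delta> (Suc p)) \<and> kmap \<Delta> pvar y = z"
proof -
  have str0: "strand b (\<lambda>_. 0 :: ('n, 'k) mpoly) = (\<lambda>_. 0)" for b by (auto simp: strand_def fun_eq_iff)
  \<comment> \<open>Choosing zero above zero strands keeps the family of preimages finite.\<close>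
  have "\<exists>y. supp_in y (kbasis \<Delta> (Suc p)) \<and> inside (Poly_Mapping.keys b) y \<and>
      kmap \<Delta> (indic (Poly_Mapping.keys b)) y = strand b z \<and> (strand b z = (\<lambda>_. 0) \<longrightarrow> y = (\<lambda>_. 0))" for b
  proof (cases "strand b z = (\<lambda>_. 0)")
    case True
    then show ?thesis by (intro exI[of _ "\<lambda>_. 0"]) (simp add: kmap_zero supp_in_def inside_def)
  next
    case False
    have "kmap \<Delta> (indic (Poly_Mapping.keys b)) (strand b z) = (\<lambda>_. 0)" if "p > 0"
      using strand_kmap[of z \<Delta> "p - 1" b] z cyc that str0 by simp
    moreover have "(\<Sum>G\<in>Pow (Poly_Mapping.keys b). strand b z ({}, G)) = 0"
      if "p = 0" "Poly_Mapping.keys b \<in> \<Delta>"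
    proof -
      have "b \<notin> Poly_Mapping.keys (kaug \<Delta> z)" using aug that by (auto simp: sr_ideal_def)
      then show ?thesis using lookup_kaug[OF \<Delta> that(2), of z] by (simp add: in_keys_iff)
    qed
    ultimately show ?thesis using False strand_exact[OF \<Delta> strand_supp[OF z] strand_inside] by blast
  qed
  then obtain y where y: "\<And>b. supp_in (y b) (kbasis \<Delta> (Suc p))" "\<And>b. inside (Poly_Mapping.keys b) (y b)"
    "\<And>b. kmap \<Delta> (indic (Poly_Mapping.keys b)) (y b) = strand b z" "\<And>b. strand b z = (\<lambda>_. 0) \<Longrightarrow> y b = (\<lambda>_. 0)"
    by metis
  have "finite {b. y b \<noteq> (\<lambda>_. 0)}"
    by (rule finite_subset[OF _ finite_strands[of z]]) (use y(4) in auto)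
  then obtain u where u: "supp_in u (kbasis \<Delta> (Suc p))" "\<And>b. strand b u = y b"
    using assemble_strands[of y "kbasis \<Delta> (Suc p)"] y(1,2) by blast
  have "kmap \<Delta> pvar u = z"
    by (rule strand_eqI[OF kmap_supp[OF u(1)] z]) (simp add: strand_kmap[OF u(1)] u(2) y(3))
  then show ?thesis using u(1) by blast
qed

section \<open>The resolution in matrix form\<close>

definition to_basis :: "'b list \<Rightarrow> (nat \<Rightarrow> 'a::comm_ring_1) \<Rightarrow> 'b \<Rightarrow> 'a" where
  "to_basis xs v = (\<lambda>x. \<Sum>s<length xs. (if x = xs ! s then 1 else 0) * v s)"

definition from_basis :: "'b list \<Rightarrow> ('b \<Rightarrow> 'a::comm_ring_1) \<Rightarrow> nat \<Rightarrow> 'a" where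
  "from_basis xs z = (\<lambda>s. if s < length xs then z (xs ! s) else 0)"

lemma to_basis_supp: "supp_in (to_basis xs v) (set xs)"
  by (auto simp: supp_in_def to_basis_def intro!: sum.neutral)

lemma to_basis_nth:
  assumes "distinct xs" "s < length xs"
  shows "to_basis xs v (xs ! s) = v s"
proof -
  have "to_basis xs v (xs ! s) = (\<Sum>t<length xs. if t = s then v t else 0)"
    unfolding to_basis_def using assms by (intro sum.cong) (auto simp: nth_eq_iff_index_eq)
  then show ?thesis using assms by simp
qed

lemma from_basis_free [simp]: "from_basis xs z \<in> free_mod (length xs)"
  by (simp add: from_basis_def free_mod_def)

lemma from_to_basis: "distinct xs \<Longrightarrow> v \<in> free_mod (length xs) \<Longrightarrow> from_basis xs (to_basis xs v) = v"
  by (auto simp: from_basis_def free_mod_def to_basis_nth fun_eq_iff not_less)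

lemma to_from_basis:
  assumes "distinct xs" "supp_in z (set xs)"
  shows "to_basis xs (from_basis xs z) = z"
proof
  fix x
  show "to_basis xs (from_basis xs z) x = z x"
  proof (cases "x \<in> set xs")
    case True
    then show ?thesis using assms(1) by (auto simp: in_set_conv_nth to_basis_nth from_basis_def)
  next
    case False
    then show ?thesis using assms(2) to_basis_supp[of xs "from_basis xs z"] by (simp add: supp_in_def)
  qed
qed

lemma from_basis_zero [simp]: "from_basis xs (\<lambda>_. 0) = 0"
  by (auto simp: from_basis_def fun_eq_iff)

text \<open>Resolutions are indexed by numbers; any fixed listing of the basis serves for the
  translation.\<close>

definition klist :: "'n::finite set set \<Rightarrow> nat \<Rightarrow> ('n set \<times> 'n set) list" where
  "klist \<Delta> p = (SOME xs. distinct xs \<and> set xs = kbasis \<Delta> p)"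

lemma klist: "distinct (klist \<Delta> p)" "set (klist \<Delta> p) = kbasis \<Delta> p"
proof -
  have "\<exists>xs. distinct xs \<and> set xs = kbasis \<Delta> p" using finite_distinct_list[of "kbasis \<Delta> p"] by auto
  then have "distinct (klist \<Delta> p) \<and> set (klist \<Delta> p) = kbasis \<Delta> p"
    unfolding klist_def by (rule someI_ex)
  then show "distinct (klist \<Delta> p)" "set (klist \<Delta> p) = kbasis \<Delta> p" by auto
qed

definition kdeg :: "'n::finite set set \<Rightarrow> nat \<Rightarrow> int list" where
  "kdeg \<Delta> p = map (\<lambda>(F, G). int (card F + card G)) (klist \<Delta> p)"

definition kmat :: "'n::finite set set \<Rightarrow> nat \<Rightarrow> nat \<Rightarrow> nat \<Rightarrow> ('n, 'k::field) mpoly" where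
  "kmat \<Delta> p t s = kmap \<Delta> pvar (\<lambda>x. if x = klist \<Delta> (Suc p) ! s then 1 else 0) (klist \<Delta> p ! t)"

definition kgen :: "'n::finite set set \<Rightarrow> nat \<Rightarrow> ('n, 'k::field) mpoly" where
  "kgen \<Delta> s = monomial (sqf (snd (klist \<Delta> 0 ! s)))"

lemma length_kdeg [simp]: "length (kdeg \<Delta> p) = length (klist \<Delta> p)"
  by (simp add: kdeg_def)

lemma mat_map_kmat:
  "mat_map (length (klist \<Delta> p)) (length (klist \<Delta> (Suc p))) (kmat \<Delta> p) v =
    from_basis (klist \<Delta> p) (kmap \<Delta> pvar (to_basis (klist \<Delta> (Suc p)) v))"
  by (auto simp: mat_map_def from_basis_def kmat_def to_basis_def kmap_sum)

lemma kgen_sum: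
  "(\<Sum>s<length (klist \<Delta> 0). kgen \<Delta> s * v s) = kaug \<Delta> (to_basis (klist \<Delta> 0) v)"
proof -
  have "(\<Sum>G\<in>\<Delta>. monomial (sqf G) * ((if ({}, G) = klist \<Delta> 0 ! s then 1 else 0) * v s)) = kgen \<Delta> s * v s"
    if "s < length (klist \<Delta> 0)" for s
  proof -
    have "klist \<Delta> 0 ! s \<in> kbasis \<Delta> 0" using that klist(2) nth_mem by blast
    then obtain G0 where G0: "klist \<Delta> 0 ! s = ({}, G0)" "G0 \<in> \<Delta>" by (auto simp: kbasis_def)
    then have "(\<Sum>G\<in>\<Delta>. monomial (sqf G) * ((if ({}, G) = klist \<Delta> 0 ! s then 1 else 0) * v s))
      = (\<Sum>G\<in>\<Delta>. if G = G0 then monomial (sqf G) * v s else 0)" by (intro sum.cong) auto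
    then show ?thesis using G0 by (simp add: kgen_def)
  qed
  then show ?thesis
    unfolding kaug_def to_basis_def sum_distrib_left by (subst sum.swap) simp
qed

lemma homogeneous_ksign_mult: "homogeneous d f \<Longrightarrow> homogeneous d (ksign a F * f)"
  for f :: "('n::finite, 'k::field) mpoly"
proof -
  have "ksign a F = (1 :: ('n, 'k) mpoly) \<or> ksign a F = (- 1 :: ('n, 'k) mpoly)" by (rule ksign_cases)
  then show "homogeneous d f \<Longrightarrow> homogeneous d (ksign a F * f)" using homogeneous_uminus[of d f] by auto
qed

lemma homogeneous_kmat:
  assumes t: "t < length (klist \<Delta> p)" and s: "s < length (klist \<Delta> (Suc p))"
  shows "homogeneous (kdeg \<Delta> (Suc p) ! s - kdeg \<Delta> p ! t) (kmat \<Delta> p t s :: ('n::finite, 'k::field) mpoly)"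
proof -
  obtain F G where FG: "klist \<Delta> (Suc p) ! s = (F, G)" by fastforce
  obtain F' G' where FG': "klist \<Delta> p ! t = (F', G')" by fastforce
  have "homogeneous (int (card F + card G) - int (card F' + card G'))
     (if a \<in> G' then - (if (insert a F', G' - {a}) = (F, G) then 1 else 0)
       else pvar a * (if (insert a F', G') = (F, G) then 1 else 0) :: ('n, 'k) mpoly)" if a: "a \<notin> F'" for a
  \<comment> \<open>Moving a between the two components keeps |F| + |G|, so the entry is a constant;
    deleting a lowers it by one, which the degree of x_a makes up for.\<close>
  proof (cases "a \<in> G'")
    case True
    then have "int (card F' + 1 + (card G' - 1)) - int (card F' + card G') = 0"
      using card_gt_0_iff[of G'] by auto
    then show ?thesis using True a by (auto simp: homogeneous_def mdeg_def)
  next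
    case False
    then show ?thesis using a by (auto simp: homogeneous_def monomial_def)
  qed
  then have "homogeneous (int (card F + card G) - int (card F' + card G')) (kmat \<Delta> p t s :: ('n, 'k) mpoly)"
    unfolding kmat_def kmap_def FG FG'
    by (auto intro!: homogeneous_sum homogeneous_ksign_mult)
  then show ?thesis using s t by (simp add: kdeg_def FG FG')
qed

lemma homogeneous_kgen:
  assumes "s < length (klist \<Delta> 0)"
  shows "homogeneous (kdeg \<Delta> 0 ! s) (kgen \<Delta> s)"
proof -
  have "klist \<Delta> 0 ! s \<in> kbasis \<Delta> 0" using assms klist(2) nth_mem by blast
  then show ?thesis using assms by (auto simp: kbasis_def kdeg_def kgen_def homogeneous_def monomial_def)
qed

theorem koszul_resolution:
  assumes \<Delta>: "down_closed \<Delta>"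
  shows "graded_free_resolution (sr_ideal \<Delta> :: ('n::finite, 'k::field) mpoly set) (kdeg \<Delta>) (kmat \<Delta>) (kgen \<Delta>)"
proof -
  let ?I = "sr_ideal \<Delta> :: ('n, 'k) mpoly set"
  let ?r = "\<lambda>p. length (klist \<Delta> p)"
  let ?\<delta> = "\<lambda>p. mat_map (?r p) (?r (Suc p)) (kmat \<Delta> p) :: (nat \<Rightarrow> ('n, 'k) mpoly) \<Rightarrow> _"
  let ?\<epsilon> = "\<lambda>v :: nat \<Rightarrow> ('n, 'k) mpoly. \<Sum>s<?r 0. kgen \<Delta> s * v s"
  have supp: "supp_in (to_basis (klist \<Delta> p) v) (kbasis \<Delta> p)" for p and v :: "nat \<Rightarrow> ('n, 'k) mpoly"
    using to_basis_supp[of "klist \<Delta> p" v] by (simp add: klist)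
  have to_from: "to_basis (klist \<Delta> p) (from_basis (klist \<Delta> p) z) = z" if "supp_in z (kbasis \<Delta> p)"
    for p and z :: "_ \<Rightarrow> ('n, 'k) mpoly"
    using that by (simp add: to_from_basis klist)
  have from_to: "from_basis (klist \<Delta> p) (to_basis (klist \<Delta> p) v) = v" if "v \<in> free_mod (?r p)"
    for p and v :: "nat \<Rightarrow> ('n, 'k) mpoly"
    using that by (simp add: from_to_basis klist)
  have to_\<delta>: "to_basis (klist \<Delta> p) (?\<delta> p v) = kmap \<Delta> pvar (to_basis (klist \<Delta> (Suc p)) v)" for p v
    unfolding mat_map_kmat by (rule to_from[OF kmap_supp[OF supp]])
  have lift: "v \<in> ?\<delta> p ` free_mod (?r (Suc p))"
    if v: "v \<in> free_mod (?r p)" and ex: "\<exists>y. supp_in y (kbasis \<Delta> (Suc p)) \<and> kmap \<Delta> pvar y = to_basis (klist \<Delta> p) v" for p v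
  proof -
    obtain y where y: "supp_in y (kbasis \<Delta> (Suc p))" "kmap \<Delta> pvar y = to_basis (klist \<Delta> p) v" using ex by blast
    then have "v = ?\<delta> p (from_basis (klist \<Delta> (Suc p)) y)"
      by (simp add: mat_map_kmat to_from from_to v)
    from image_eqI[of v "?\<delta> p", OF this from_basis_free] show ?thesis .
  qed
  have "\<exists>v\<in>free_mod (?r 0). f - ?\<epsilon> v \<in> ?I" for f
  proof (cases "{} \<in> \<Delta>")
    case True
    \<comment> \<open>The basis element ({}, {}) is sent to 1, so f times it has augmentation
      f.\<close>
    define z where "z = (\<lambda>x :: 'n set \<times> 'n set. if x = ({}, {}) then f else 0)"
    have "supp_in z (kbasis \<Delta> 0)" using True by (auto simp: supp_in_def z_def kbasis_def)
    moreover have "kaug \<Delta> z = (\<Sum>G\<in>\<Delta>. if G = {} then monomial (sqf G) * f else 0)"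
      unfolding kaug_def by (rule sum.cong) (auto simp: z_def)
    moreover have "monomial (sqf {}) = (1 :: ('n, 'k) mpoly)"
      using poly_mapping_eqI[of "sqf {} :: 'n \<Rightarrow>\<^sub>0 nat" 0] by (simp add: lookup_sqf monomial_def)
    ultimately have "f - ?\<epsilon> (from_basis (klist \<Delta> 0) z) = 0" using True
      unfolding kgen_sum by (simp add: to_from)
    then show ?thesis by (intro bexI[of _ "from_basis (klist \<Delta> 0) z"]) (simp_all only: from_basis_free, simp add: sr_ideal_def)
  next
    case False
    \<comment> \<open>Without the empty face there are no faces at all, the ideal is the whole ring,
      and the zero vector serves.\<close>
    then have "\<Delta> = {}" using \<Delta> by (auto simp: down_closed_def)
    then show ?thesis by (intro bexI[of _ 0]) (simp_all add: sr_ideal_def free_mod_def)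
  qed
  moreover have "{v \<in> free_mod (?r 0). ?\<epsilon> v \<in> ?I} = ?\<delta> 0 ` free_mod (?r (Suc 0))"
  proof (intro equalityI subsetI)
    fix v assume "v \<in> {v \<in> free_mod (?r 0). ?\<epsilon> v \<in> ?I}"
    then show "v \<in> ?\<delta> 0 ` free_mod (?r (Suc 0))"
      using kmap_exact[OF \<Delta> supp[of 0 v]] by (intro lift) (auto simp: kgen_sum)
  next
    fix v assume "v \<in> ?\<delta> 0 ` free_mod (?r (Suc 0))"
    then show "v \<in> {v \<in> free_mod (?r 0). ?\<epsilon> v \<in> ?I}"
      using kaug_kmap[unfolded One_nat_def, OF \<Delta> supp] by (auto simp: kgen_sum to_\<delta>)
  qed
  moreover have "{v \<in> free_mod (?r (Suc p)). ?\<delta> p v = (\<lambda>_. 0)} = ?\<delta> (Suc p) ` free_mod (?r (Suc (Suc p)))" for p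
  proof (intro equalityI subsetI)
    fix v assume v: "v \<in> {v \<in> free_mod (?r (Suc p)). ?\<delta> p v = (\<lambda>_. 0)}"
    have "to_basis (klist \<Delta> p) (\<lambda>_. 0 :: ('n, 'k) mpoly) = (\<lambda>_. 0)" by (simp add: to_basis_def)
    then have "kmap \<Delta> pvar (to_basis (klist \<Delta> (Suc p)) v) = (\<lambda>_. 0)" using v to_\<delta>[of p v] by simp
    then show "v \<in> ?\<delta> (Suc p) ` free_mod (?r (Suc (Suc p)))"
      using v kmap_exact[OF \<Delta> supp[of "Suc p" v]] by (intro lift) auto
  next
    fix v assume "v \<in> ?\<delta> (Suc p) ` free_mod (?r (Suc (Suc p)))"
    then obtain w where w: "v = ?\<delta> (Suc p) w" by blast
    have "?\<delta> p v = from_basis (klist \<Delta> p) (kmap \<Delta> pvar (to_basis (klist \<Delta> (Suc p)) v))" by (rule mat_map_kmat)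
    also have "\<dots> = (\<lambda>_. 0)" unfolding w to_\<delta> kmap_kmap[OF \<Delta>] by (simp add: zero_fun_def)
    finally show "v \<in> {v \<in> free_mod (?r (Suc p)). ?\<delta> p v = (\<lambda>_. 0)}" using w by simp
  qed
  ultimately show ?thesis
    unfolding graded_free_resolution_def Let_def length_kdeg
    by (simp add: homogeneous_kmat homogeneous_kgen)
qed

section \<open>Betti numbers as Koszul homology\<close>

text \<open>Vectors over the finite type of all pairs give access to the dimension theory of
  coordinate spaces and make the listing of the basis disappear.\<close>

definition kchains :: "'n::finite set set \<Rightarrow> nat \<Rightarrow> nat \<Rightarrow> ('k::field ^ ('n set \<times> 'n set)) set" where
  "kchains \<Delta> i d = {v. supp_in (($) v) {x \<in> kbasis \<Delta> i. card (fst x) + card (snd x) = d}}"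

definition kdiff :: "'n::finite set set \<Rightarrow> 'k::field ^ ('n set \<times> 'n set) \<Rightarrow> 'k ^ ('n set \<times> 'n set)" where
  "kdiff \<Delta> v = (\<chi> x. kmap \<Delta> (\<lambda>_. 0) (($) v) x)"

definition kcycles :: "'n::finite set set \<Rightarrow> nat \<Rightarrow> nat \<Rightarrow> ('k::field ^ ('n set \<times> 'n set)) set" where
  "kcycles \<Delta> i d = {v \<in> kchains \<Delta> i d. kdiff \<Delta> v = 0}"

definition kbounds :: "'n::finite set set \<Rightarrow> nat \<Rightarrow> nat \<Rightarrow> ('k::field ^ ('n set \<times> 'n set)) set" where
  "kbounds \<Delta> i d = kdiff \<Delta> ` kchains \<Delta> (Suc i) d"

lemma kchains_supp: "v \<in> kchains \<Delta> i d \<Longrightarrow> supp_in (($) v) (kbasis \<Delta> i)"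
  by (auto simp: kchains_def supp_in_def)

lemma kdiff_nth: "kdiff \<Delta> v $ (F, G) = (if G \<in> \<Delta> then - (\<Sum>a\<in>G - F. ksign a F * v $ (insert a F, G - {a})) else 0)"
proof -
  have "(\<Sum>a\<in>-F. ksign a F * (if a \<in> G then - (v $ (insert a F, G - {a})) else 0 * v $ (insert a F, G))) =
    (\<Sum>a\<in>G - F. - (ksign a F * v $ (insert a F, G - {a})))"
    by (rule sum.mono_neutral_cong_right) auto
  then show ?thesis by (simp add: kdiff_def kmap_def sum_negf)
qed

lemma kdiff_kchains: "v \<in> kchains \<Delta> (Suc i) d \<Longrightarrow> kdiff \<Delta> v \<in> kchains \<Delta> i d"
proof -
  assume v: "v \<in> kchains \<Delta> (Suc i) d"
  have "kdiff \<Delta> v $ (F, G) = 0" if "\<not> ((F, G) \<in> kbasis \<Delta> i \<and> card F + card G = d)" for F G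
  proof (cases "(F, G) \<in> kbasis \<Delta> i")
    case False
    then show ?thesis using kmap_supp[OF kchains_supp[OF v], of "\<lambda>_. 0"] by (simp add: kdiff_def supp_in_def)
  next
    case True
    then have "card F + card G \<noteq> d" using that by simp
    then have "card (insert a F) + card (G - {a}) \<noteq> d" if "a \<in> G - F" for a
      using that card_Suc_Diff1[of G a] by simp
    then have "v $ (insert a F, G - {a}) = 0" if "a \<in> G - F" for a
      using v that by (simp add: kchains_def supp_in_def)
    then show ?thesis by (simp add: kdiff_nth)
  qed
  then show ?thesis by (auto simp: kchains_def supp_in_def)
qed

lemma kdiff_kdiff: "down_closed \<Delta> \<Longrightarrow> kdiff \<Delta> (kdiff \<Delta> v) = 0"
  using kmap_kmap[of \<Delta> "\<lambda>_. 0" "($) v"] by (simp add: kdiff_def vec_eq_iff fun_eq_iff vec_lambda_inverse)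

lemma kdiff_0: "v \<in> kchains \<Delta> 0 d \<Longrightarrow> kdiff \<Delta> v = 0"
proof -
  assume "v \<in> kchains \<Delta> 0 d"
  then have "v $ (insert a F, G) = 0" for a F G
    by (auto simp: kchains_def supp_in_def kbasis_def)
  then show ?thesis by (simp add: vec_eq_iff kdiff_nth)
qed

lemma linear_kdiff: "Vector_Spaces.linear (*s) (*s) (kdiff \<Delta>)"
  by unfold_locales
   (auto simp: vec_eq_iff kdiff_nth algebra_simps sum.distrib sum_negf[symmetric] sum_distrib_left
     intro!: sum.cong)

lemma subspace_kchains: "vec.subspace (kchains \<Delta> i d)"
  by (auto simp: vec.subspace_def kchains_def supp_in_def)

lemma subspace_kcycles: "vec.subspace (kcycles \<Delta> i d :: ('k::field ^ ('n::finite set \<times> 'n set)) set)"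
proof -
  interpret l: Vector_Spaces.linear "(*s)" "(*s)" "kdiff \<Delta> :: 'k ^ ('n set \<times> 'n set) \<Rightarrow> _" by (rule linear_kdiff)
  have "(kcycles \<Delta> i d :: ('k ^ ('n set \<times> 'n set)) set) = kchains \<Delta> i d \<inter> {v. kdiff \<Delta> v = 0}" by (auto simp: kcycles_def)
  then show ?thesis by (simp only:) (intro vec.subspace_inter subspace_kchains l.subspace_kernel)
qed

lemma subspace_kbounds: "vec.subspace (kbounds \<Delta> i d)"
proof -
  interpret l: Vector_Spaces.linear "(*s)" "(*s)" "kdiff \<Delta>" by (rule linear_kdiff)
  show ?thesis unfolding kbounds_def by (rule l.subspace_image[OF subspace_kchains])
qed

lemma kbounds_kcycles: "down_closed \<Delta> \<Longrightarrow> kbounds \<Delta> i d \<subseteq> kcycles \<Delta> i d"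
  by (auto simp: kbounds_def kcycles_def kdiff_kchains kdiff_kdiff)

lemma lookup_kmap_0:
  fixes z :: "'n::finite set \<times> 'n set \<Rightarrow> ('n, 'k::field) mpoly"
  shows "Poly_Mapping.lookup (kmap \<Delta> pvar z x) 0 = kmap \<Delta> (\<lambda>_. 0) (\<lambda>x. Poly_Mapping.lookup (z x) 0) x"
proof (cases x)
  case (Pair F G)
  have "Poly_Mapping.lookup (pvar a :: ('n, 'k) mpoly) 0 = 0" for a
  proof -
    have "sqf {a} \<noteq> (0 :: 'n \<Rightarrow>\<^sub>0 nat)" by (metis insert_not_empty keys_sqf keys_zero)
    then show ?thesis by (simp add: monomial_def lookup_single)
  qed
  then have "Poly_Mapping.lookup (if a \<in> G then - z (insert a F, G - {a}) else pvar a * z (insert a F, G)) 0 =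
     (if a \<in> G then - Poly_Mapping.lookup (z (insert a F, G - {a})) 0
      else 0 * Poly_Mapping.lookup (z (insert a F, G)) 0)" for a
    by (simp add: lookup_mult_0)
  then show ?thesis by (simp add: Pair kmap_def lookup_sum lookup_ksign_mult)
qed

lemma tor_diff_koszul:
  "tor_diff (kdeg \<Delta>) (kmat \<Delta> :: _ \<Rightarrow> _ \<Rightarrow> _ \<Rightarrow> ('n::finite, 'k::field) mpoly) p v =
    from_basis (klist \<Delta> p) (kmap \<Delta> (\<lambda>_. 0) (to_basis (klist \<Delta> (Suc p)) v))"
proof -
  have *: "Poly_Mapping.lookup (if P then 1 else 0 :: ('n, 'k) mpoly) 0 = (if P then 1 else 0)" for P
    by simp
  have "const_mat (kmat \<Delta> p :: _ \<Rightarrow> _ \<Rightarrow> ('n, 'k) mpoly) t s = kmap \<Delta> (\<lambda>_. 0) (\<lambda>x. if x = klist \<Delta> (Suc p) ! s then 1 else 0) (klist \<Delta> p ! t)" for t s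
    unfolding kmat_def lookup_kmap_0 * ..
  then show ?thesis by (auto simp: tor_diff_def mat_map_def from_basis_def to_basis_def kmap_sum)
qed

interpretation fun_vec: vector_space_pair "fscale :: 'k::field \<Rightarrow> _" "(*s) :: 'k \<Rightarrow> 'k ^ 'b::finite \<Rightarrow> _" ..
interpretation vec_fun: vector_space_pair "(*s) :: 'k::field \<Rightarrow> 'k ^ 'b::finite \<Rightarrow> _" "fscale :: 'k \<Rightarrow> _" ..

text \<open>The translations \<open>f\<close> and \<open>g\<close> are mutually inverse on chains of
  degree d and respect the differentials, so \<open>dim_quotient_le\<close> applies in both
  directions.\<close>

lemma tor_dim_koszul:
  assumes \<Delta>: "down_closed \<Delta>"
  shows "tor_dim (kdeg \<Delta>) (kmat \<Delta> :: _ \<Rightarrow> _ \<Rightarrow> _ \<Rightarrow> ('n::finite, 'k::field) mpoly) i (int d) =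
    vec.dim (kcycles \<Delta> i d :: ('k ^ ('n set \<times> 'n set)) set) - vec.dim (kbounds \<Delta> i d :: ('k ^ ('n set \<times> 'n set)) set)"
proof -
  let ?D = "kmat \<Delta> :: _ \<Rightarrow> _ \<Rightarrow> _ \<Rightarrow> ('n, 'k) mpoly"
  interpret R: graded_res "sr_ideal \<Delta> :: ('n, 'k) mpoly set" "kdeg \<Delta>" ?D "kgen \<Delta>"
    by unfold_locales (rule koszul_resolution[OF \<Delta>] hom_ideal_sr_ideal[OF \<Delta>])+
  define f where "f = (\<lambda>p v. (\<chi> x. to_basis (klist \<Delta> p) v x) :: 'k ^ ('n set \<times> 'n set))"
  define g where "g = (\<lambda>p (u :: 'k ^ ('n set \<times> 'n set)). from_basis (klist \<Delta> p) (($) u))"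
  have gf: "g p (f p v) = v" if "v \<in> tor_chains (kdeg \<Delta>) p (int d)" for p v
    using tor_chains_free[OF that] by (simp add: f_def g_def vec_lambda_inverse from_to_basis klist)
  have fg: "f p (g p u) = u" if "u \<in> kchains \<Delta> p d" for p u
    using kchains_supp[OF that] by (simp add: f_def g_def to_from_basis klist)
  have f_ch: "f p v \<in> kchains \<Delta> p d" if v: "v \<in> tor_chains (kdeg \<Delta>) p (int d)" for p v
  proof -
    have "to_basis (klist \<Delta> p) v x = 0" if x: "\<not> (x \<in> kbasis \<Delta> p \<and> card (fst x) + card (snd x) = d)" for x
    proof (cases "x \<in> kbasis \<Delta> p")
      case True
      then obtain s where s: "s < length (klist \<Delta> p)" "x = klist \<Delta> p ! s" using klist(2) by (metis in_set_conv_nth)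
      then have "kdeg \<Delta> p ! s \<noteq> int d" using True x by (auto simp: kdeg_def split: prod.split)
      then have "v s = 0" using v s by (auto simp: tor_chains_def)
      then show ?thesis using s by (simp add: to_basis_nth klist)
    next
      case False
      then show ?thesis using to_basis_supp[of "klist \<Delta> p" v] by (cases x) (simp add: supp_in_def klist)
    qed
    then show ?thesis by (simp add: kchains_def f_def supp_in_def)
  qed
  have g_ch: "g p u \<in> tor_chains (kdeg \<Delta>) p (int d)" if u: "u \<in> kchains \<Delta> p d" for p u
  proof -
    have "kdeg \<Delta> p ! s = int d" if "s < length (klist \<Delta> p)" "u $ (klist \<Delta> p ! s) \<noteq> 0" for s
      using u that by (force simp: kchains_def supp_in_def kdeg_def split: prod.split)
    then show ?thesis by (simp add: tor_chains_def g_def from_basis_free) (simp add: from_basis_def)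
  qed
  have f_d: "f p (tor_diff (kdeg \<Delta>) ?D p v) = kdiff \<Delta> (f (Suc p) v)"
    if "v \<in> tor_chains (kdeg \<Delta>) (Suc p) (int d)" for p v
  proof -
    have "supp_in (to_basis (klist \<Delta> (Suc p)) v) (kbasis \<Delta> (Suc p))"
      using to_basis_supp[of "klist \<Delta> (Suc p)" v] by (simp add: klist)
    then show ?thesis
      by (simp add: f_def tor_diff_koszul kdiff_def to_from_basis klist kmap_supp vec_lambda_inverse)
  qed
  have f_cyc: "f i v \<in> kcycles \<Delta> i d" if v: "v \<in> tor_cycles (kdeg \<Delta>) ?D i (int d)" for v
  proof (cases i)
    case 0
    then show ?thesis using v f_ch[of v 0] kdiff_0[of "f 0 v" \<Delta> d] by (simp add: tor_cycles_def kcycles_def)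
  next
    case (Suc p)
    then have "kdiff \<Delta> (f (Suc p) v) = f p 0" "f i v \<in> kchains \<Delta> i d"
      using v f_d[of v p] f_ch[of v i] by (auto simp: tor_cycles_def zero_fun_def)
    moreover have "f p 0 = 0" by (simp add: f_def to_basis_def vec_eq_iff)
    ultimately show ?thesis by (simp add: Suc kcycles_def)
  qed
  have g_cyc: "g i u \<in> tor_cycles (kdeg \<Delta>) ?D i (int d)" if u: "u \<in> kcycles \<Delta> i d" for u
  proof -
    have uch: "u \<in> kchains \<Delta> i d" "kdiff \<Delta> u = 0" using u by (auto simp: kcycles_def)
    show ?thesis
    proof (cases i)
      case 0
      then show ?thesis using g_ch uch by (simp add: tor_cycles_def)
    next
      case (Suc p)
      have gc: "g i u \<in> tor_chains (kdeg \<Delta>) (Suc p) (int d)" using g_ch[OF uch(1)] Suc by simp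
      have "f p (tor_diff (kdeg \<Delta>) ?D p (g i u)) = 0" using f_d[OF gc] fg[OF uch(1)] uch(2) Suc by simp
      then have "tor_diff (kdeg \<Delta>) ?D p (g i u) = g p 0"
        using gf[OF R.tor_diff_chains[OF gc]] by simp
      also have "g p 0 = 0" by (auto simp: g_def from_basis_def fun_eq_iff)
      finally show ?thesis using gc by (simp add: Suc tor_cycles_def zero_fun_def)
    qed
  qed
  have linf: "Vector_Spaces.linear fscale (*s) (f i)"
    by unfold_locales (auto simp: f_def to_basis_def fscale_def vec_eq_iff algebra_simps sum.distrib sum_distrib_left)
  have ling: "Vector_Spaces.linear (*s) fscale (g i)"
    by unfold_locales (auto simp: g_def from_basis_def fscale_def fun_eq_iff)
  obtain W :: "(nat \<Rightarrow> 'k) set" where W: "finite W" "tor_cycles (kdeg \<Delta>) ?D i (int d) \<subseteq> fun_vs.span W"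
    using R.tor_cycles_finite_span by blast
  have le1: "tor_dim (kdeg \<Delta>) ?D i (int d) \<le> vec.dim (kcycles \<Delta> i d :: ('k ^ ('n set \<times> 'n set)) set)
      - vec.dim (kbounds \<Delta> i d :: ('k ^ ('n set \<times> 'n set)) set)"
    unfolding tor_dim_def
  proof (rule fun_vec.dim_quotient_le[OF linf R.subspace_tor_cycles W(2,1) subspace_kcycles _ finite_cart_basis
        R.subspace_tor_boundaries R.tor_boundaries_cycles subspace_kbounds kbounds_kcycles[OF \<Delta>] f_cyc])
    show "v \<in> tor_boundaries (kdeg \<Delta>) ?D i (int d)"
      if vz: "v \<in> tor_cycles (kdeg \<Delta>) ?D i (int d)" and vb: "f i v \<in> kbounds \<Delta> i d" for v
    proof -
      obtain u where u: "u \<in> kchains \<Delta> (Suc i) d" "f i v = kdiff \<Delta> u" using vb by (auto simp: kbounds_def)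
      have "f i v = f i (tor_diff (kdeg \<Delta>) ?D i (g (Suc i) u))"
        using f_d[OF g_ch[OF u(1)]] fg[OF u(1)] u(2) by simp
      then have "v = tor_diff (kdeg \<Delta>) ?D i (g (Suc i) u)"
        using gf vz R.tor_cycles_chains R.tor_diff_chains[OF g_ch[OF u(1)]] by (metis subsetD)
      then show ?thesis using g_ch[OF u(1)] by (auto simp: tor_boundaries_def)
    qed
  qed (auto simp: span_cart_basis)
  have le2: "vec.dim (kcycles \<Delta> i d :: ('k ^ ('n set \<times> 'n set)) set)
      - vec.dim (kbounds \<Delta> i d :: ('k ^ ('n set \<times> 'n set)) set) \<le> tor_dim (kdeg \<Delta>) ?D i (int d)"
    unfolding tor_dim_def
  proof (rule vec_fun.dim_quotient_le[OF ling subspace_kcycles _ finite_cart_basis R.subspace_tor_cycles W(2,1)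
        subspace_kbounds kbounds_kcycles[OF \<Delta>] R.subspace_tor_boundaries R.tor_boundaries_cycles g_cyc])
    show "u \<in> kbounds \<Delta> i d"
      if uz: "u \<in> kcycles \<Delta> i d" and ub: "g i u \<in> tor_boundaries (kdeg \<Delta>) ?D i (int d)" for u
    proof -
      obtain w where w: "w \<in> tor_chains (kdeg \<Delta>) (Suc i) (int d)" "g i u = tor_diff (kdeg \<Delta>) ?D i w"
        using ub by (auto simp: tor_boundaries_def)
      have "u = f i (g i u)" using fg[of u i] uz by (simp add: kcycles_def)
      also have "\<dots> = kdiff \<Delta> (f (Suc i) w)" using w f_d by simp
      finally show ?thesis using f_ch[OF w(1)] by (auto simp: kbounds_def)
    qed
  qed (auto simp: span_cart_basis)
  show ?thesis using le1 le2 by simp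
qed

definition koszul_betti :: "'k::field itself \<Rightarrow> 'n::finite set set \<Rightarrow> nat \<Rightarrow> nat \<Rightarrow> nat" where
  "koszul_betti _ \<Delta> i d = vec.dim (kcycles \<Delta> i d :: ('k ^ ('n set \<times> 'n set)) set)
      - vec.dim (kbounds \<Delta> i d :: ('k ^ ('n set \<times> 'n set)) set)"

theorem graded_betti_sr_ideal:
  assumes "down_closed \<Delta>"
  shows "graded_betti (sr_ideal \<Delta> :: ('n::finite, 'k::field) mpoly set) i (int d) = koszul_betti TYPE('k) \<Delta> i d"
  unfolding graded_betti_eq[OF koszul_resolution[OF assms] hom_ideal_sr_ideal[OF assms]]
    tor_dim_koszul[OF assms] koszul_betti_def ..

section \<open>Truncations and Euler characteristics\<close>

lemma dim_supp_in:
  "vec.dim {v :: 'k::field ^ 'b::finite. supp_in (($) v) S} = card S"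
proof -
  let ?V = "{v :: 'k ^ 'b. supp_in (($) v) S}" and ?B = "(\<lambda>x. axis x (1 :: 'k)) ` S"
  have "?B \<subseteq> ?V" by (auto simp: supp_in_def axis_def)
  moreover have "v \<in> vec.span ?B" if "v \<in> ?V" for v
  proof -
    have "v = (\<Sum>x\<in>S. v $ x *s axis x 1)"
      using that by (auto simp: vec_eq_iff axis_def supp_in_def if_distrib cong: if_cong)
    also have "\<dots> \<in> vec.span ?B"
      by (intro vec.span_sum vec.span_scale vec.span_base imageI)
    finally show ?thesis .
  qed
  moreover have "vec.independent ?B"
    by (rule vec.independent_mono[OF independent_cart_basis]) (auto simp: cart_basis_def)
  ultimately have "card ?B = vec.dim ?V" by (intro vec.basis_card_eq_dim) auto
  moreover have "card ?B = card S" by (rule card_image) (auto simp: inj_on_def axis_eq_axis)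
  ultimately show ?thesis by simp
qed

lemma dim_kchains:
  "vec.dim (kchains \<Delta> i d :: ('k::field ^ ('n::finite set \<times> 'n set)) set) =
    card {x \<in> kbasis \<Delta> i. card (fst x) + card (snd x) = d}"
  unfolding kchains_def by (rule dim_supp_in)

text \<open>The face G is chosen first, then F inside its complement. With r = d - l this is the
  origin of the binomial coefficient in \<open>alpha\<close>.\<close>

lemma card_kchains_index:
  fixes \<Delta> :: "'n::finite set set"
  assumes "l \<le> d"
  shows "card {x \<in> kbasis \<Delta> l. card (fst x) + card (snd x) = d} =
    (CARD('n) - (d - l) choose l) * num_faces \<Delta> (d - l)"
proof -
  define S where "S = {G \<in> \<Delta>. card G = d - l}"
  have "bij_betw prod.swap (Sigma S (\<lambda>G. {F. F \<subseteq> - G \<and> card F = l}))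
      {x \<in> kbasis \<Delta> l. card (fst x) + card (snd x) = d}"
    by (rule bij_betwI[where g = prod.swap]) (use assms in \<open>auto simp: S_def kbasis_def\<close>)
  then have "card {x \<in> kbasis \<Delta> l. card (fst x) + card (snd x) = d} =
      (\<Sum>G\<in>S. card {F. F \<subseteq> - G \<and> card F = l})"
    by (simp add: bij_betw_same_card[symmetric])
  also have "\<dots> = (\<Sum>G\<in>S. CARD('n) - (d - l) choose l)"
    by (rule sum.cong) (auto simp: n_subsets S_def Compl_eq_Diff_UNIV card_Diff_subset)
  finally show ?thesis by (simp add: S_def num_faces_def)
qed

text \<open>\<open>dim_quotient_le\<close> is applied to \<open>f\<close> and to a right inverse of
  \<open>f\<close> on the image, comparing V modulo the kernel with the image modulo zero.\<close>

lemma (in vector_space_pair) rank_nullity: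
  assumes lf: "Vector_Spaces.linear s1 s2 f" and V: "vs1.subspace V" "V \<subseteq> vs1.span W" "finite W"
  shows "vs1.dim V - vs1.dim {v \<in> V. f v = 0} = vs2.dim (f ` V)"
proof -
  interpret f: Vector_Spaces.linear s1 s2 f by (fact lf)
  interpret swap: vector_space_pair s2 s1 ..
  obtain g where g: "Vector_Spaces.linear s2 s1 g" "range g \<subseteq> V" "\<And>v. v \<in> f ` V \<Longrightarrow> f (g v) = v"
    using linear_exists_right_inverse_on[OF lf V(1)] by auto
  have K: "vs1.subspace {v \<in> V. f v = 0}"
    using vs1.subspace_inter[OF V(1) f.subspace_kernel] by (simp add: Int_def)
  have fV: "vs2.subspace (f ` V)" by (rule f.subspace_image[OF V(1)])
  have fW: "f ` V \<subseteq> vs2.span (f ` W)" using V(2) f.span_image[of W] by auto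
  have Z: "vs2.dim {0} = 0"
    using vs2.dim_le_card[of "{0}" "{}"] by simp
  have "vs1.dim V - vs1.dim {v \<in> V. f v = 0} \<le> vs2.dim (f ` V) - vs2.dim {0}"
    by (rule dim_quotient_le[OF lf V fV fW _ K])
      (use V(3) vs2.subspace_0[OF fV] in \<open>auto simp: vs2.subspace_single_0\<close>)
  moreover have "vs2.dim (f ` V) - vs2.dim {0} \<le> vs1.dim V - vs1.dim {v \<in> V. f v = 0}"
    by (rule swap.dim_quotient_le[OF g(1) fV fW _ V vs2.subspace_single_0 _ K])
      (use V(3) g vs2.subspace_0[OF fV] in auto)
  ultimately show ?thesis by (simp add: Z)
qed

lemma dim_kchains_Suc:
  "vec.dim (kchains \<Delta> (Suc i) d :: ('k::field ^ ('n::finite set \<times> 'n set)) set) =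
    vec.dim (kcycles \<Delta> (Suc i) d :: ('k ^ ('n set \<times> 'n set)) set) +
    vec.dim (kbounds \<Delta> i d :: ('k ^ ('n set \<times> 'n set)) set)"
proof -
  let ?C = "kchains \<Delta> (Suc i) d :: ('k ^ ('n set \<times> 'n set)) set"
  have "vec.dim ?C - vec.dim {v \<in> ?C. kdiff \<Delta> v = 0} = vec.dim (kdiff \<Delta> ` ?C)"
    by (rule vec.rank_nullity[OF linear_kdiff subspace_kchains _ finite_cart_basis]) (simp add: span_cart_basis)
  moreover have "vec.dim {v \<in> ?C. kdiff \<Delta> v = 0} \<le> vec.dim ?C"
    by (rule vec.dim_subset) auto
  ultimately show ?thesis by (simp add: kcycles_def kbounds_def)
qed

lemma kchains_trivial:
  assumes "d < i"
  shows "kchains \<Delta> i d = {0}"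
  using assms by (auto simp: kchains_def kbasis_def supp_in_def vec_eq_iff)

lemma kbounds_trivial:
  assumes "d \<le> i"
  shows "kbounds \<Delta> i d = {0}"
proof -
  have "kdiff \<Delta> 0 = 0" by (simp add: vec_eq_iff kdiff_nth)
  then show ?thesis using assms by (simp add: kbounds_def kchains_trivial)
qed

lemma koszul_betti_0_0:
  assumes "down_closed \<Delta>" "{} \<in> \<Delta>"
  shows "koszul_betti TYPE('k::field) \<Delta> 0 0 = 1"
proof -
  have "{x \<in> kbasis \<Delta> 0. card (fst x) + card (snd x) = 0} = {({}, {})}"
    using assms(2) by (auto simp: kbasis_def)
  then have "vec.dim (kchains \<Delta> 0 0 :: ('k ^ _) set) = 1" by (simp add: dim_kchains)
  moreover have "kcycles \<Delta> 0 0 = (kchains \<Delta> 0 0 :: ('k ^ _) set)"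
    using kdiff_0 by (auto simp: kcycles_def)
  ultimately show ?thesis by (simp add: koszul_betti_def kbounds_trivial)
qed

lemma koszul_betti_euler:
  assumes "down_closed (\<Delta> :: 'n::finite set set)"
  shows "(\<Sum>l\<le>d. (- 1) ^ l * real (koszul_betti TYPE('k::field) \<Delta> l d)) =
    (\<Sum>r\<le>d. (- 1) ^ (d - r) * real (CARD('n) - r choose (d - r)) * real (num_faces \<Delta> r))"
proof -
  define z where "z = (\<lambda>l. vec.dim (kcycles \<Delta> l d :: ('k ^ ('n set \<times> 'n set)) set))"
  define b where "b = (\<lambda>l. vec.dim (kbounds \<Delta> l d :: ('k ^ ('n set \<times> 'n set)) set))"
  define c where "c = (\<lambda>l. vec.dim (kchains \<Delta> l d :: ('k ^ ('n set \<times> 'n set)) set))"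
  have "b l \<le> z l" for l
    unfolding b_def z_def by (rule vec.dim_subset[OF kbounds_kcycles[OF assms]])
  then have h: "real (koszul_betti TYPE('k) \<Delta> l d) = real (z l) - real (b l)" for l
    by (simp add: koszul_betti_def z_def b_def of_nat_diff)
  have "kcycles \<Delta> 0 d = (kchains \<Delta> 0 d :: ('k ^ ('n set \<times> 'n set)) set)"
    using kdiff_0 by (auto simp: kcycles_def)
  then have c0: "c 0 = z 0" by (simp add: c_def z_def)
  have cSuc: "c (Suc l) = z (Suc l) + b l" for l unfolding c_def z_def b_def by (rule dim_kchains_Suc)
  \<comment> \<open>The boundaries telescope except for those in degree m. For m = d these vanish,
    as no pair of internal degree d has |F| = d + 1.\<close>
  have "(\<Sum>l\<le>m. (- 1) ^ l * (real (z l) - real (b l))) = (\<Sum>l\<le>m. (- 1) ^ l * real (c l)) - (- 1) ^ m * real (b m)" for m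
    by (induction m) (simp_all add: c0 cSuc algebra_simps)
  from this[of d] have "(\<Sum>l\<le>d. (- 1) ^ l * real (koszul_betti TYPE('k) \<Delta> l d)) = (\<Sum>l\<le>d. (- 1) ^ l * real (c l))"
    by (simp add: h) (simp add: b_def kbounds_trivial)
  also have "\<dots> = (\<Sum>l\<le>d. (- 1) ^ l * real (CARD('n) - (d - l) choose l) * real (num_faces \<Delta> (d - l)))"
    by (intro sum.cong) (simp_all add: c_def dim_kchains card_kchains_index)
  also have "\<dots> = (\<Sum>r\<le>d. (- 1) ^ (d - r) * real (CARD('n) - r choose (d - r)) * real (num_faces \<Delta> r))"
    by (rule sum.reindex_bij_witness[of _ "\<lambda>r. d - r" "\<lambda>r. d - r"]) auto
  finally show ?thesis .
qed

text \<open>In this range all \<open>G\<close> that occur are faces, so moving a chosen element of \<open>F \<union> G\<close> from \<open>G\<close> to \<open>F\<close>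
  is a contracting homotopy.\<close>

lemma koszul_betti_vanish:
  fixes \<Delta> :: "'n::finite set set"
  assumes \<Delta>: "down_closed \<Delta>" and small: "\<And>A. card A < k \<Longrightarrow> A \<in> \<Delta>"
    and i: "i > 0" "d + 2 \<le> i + k"
  shows "koszul_betti TYPE('k::field) \<Delta> i d = 0"
proof -
  have "v \<in> kbounds \<Delta> i d" if v: "v \<in> kcycles \<Delta> i d" for v :: "'k ^ ('n set \<times> 'n set)"
  proof -
    \<comment> \<open>The choice depends only on F \<union> G, which the differential preserves, so
      all terms below use the same element.\<close>
    define c where "c = (\<lambda>U :: 'n set. SOME a. a \<in> U)"
    define w where "w = (\<chi> x. let (F, G) = x; a = c (F \<union> G) in
      if F \<inter> G = {} \<and> a \<in> F then - (ksign a F * v $ (F - {a}, insert a G)) else 0)"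
    have w: "w $ (F, G) = (if F \<inter> G = {} \<and> c (F \<union> G) \<in> F then
      - (ksign (c (F \<union> G)) F * v $ (F - {c (F \<union> G)}, insert (c (F \<union> G)) G)) else 0)" for F G
      by (simp add: w_def Let_def)
    have vch: "v $ (F, G) = 0" if "\<not> (F \<inter> G = {} \<and> G \<in> \<Delta> \<and> card F = i \<and> card F + card G = d)" for F G
      using v that by (auto simp: kcycles_def kchains_def supp_in_def kbasis_def)
    have wch: "w \<in> kchains \<Delta> (Suc i) d"
    proof -
      have *: "F \<inter> G = {} \<and> G \<in> \<Delta> \<and> card F = Suc i \<and> card F + card G = d" if nz: "w $ (F, G) \<noteq> 0" for F G
      proof -
        define a where "a = c (F \<union> G)"
        have a: "F \<inter> G = {}" "a \<in> F" "v $ (F - {a}, insert a G) \<noteq> 0"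
          using nz by (auto simp: w a_def split: if_splits)
        then have v': "insert a G \<in> \<Delta>" "card (F - {a}) = i" "card (F - {a}) + card (insert a G) = d"
          using vch by blast+
        have "G \<in> \<Delta>" using v'(1) \<Delta> unfolding down_closed_def by blast
        moreover have "card F = Suc i" using v'(2) a card_Suc_Diff1[of F a] by simp
        moreover have "card (insert a G) = Suc (card G)" using a by (intro card_insert_disjoint) auto
        ultimately show ?thesis using a v' by simp
      qed
      have "x \<in> kbasis \<Delta> (Suc i) \<and> card (fst x) + card (snd x) = d" if "w $ x \<noteq> 0" for x
        using *[of "fst x" "snd x"] that by (cases x) (simp add: kbasis_def)
      then show ?thesis unfolding kchains_def supp_in_def by blast
    qed
    have "kdiff \<Delta> w $ (F, G) = v $ (F, G)" for F G
    proof (cases "F \<inter> G = {} \<and> G \<in> \<Delta> \<and> card F = i \<and> card F + card G = d")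
      case False
      then show ?thesis using vch[OF False] kdiff_kchains[OF wch]
        by (auto simp: kchains_def supp_in_def kbasis_def)
    next
      case True
      define a where "a = c (F \<union> G)"
      \<comment> \<open>Positive homological degree guarantees an element to choose; for i = 0 the
        pair ({}, {}) offers none.\<close>
      have "F \<union> G \<noteq> {}" using True i(1) by auto
      then have aU: "a \<in> F \<union> G" unfolding a_def c_def by (rule some_in_eq[THEN iffD2])
      have GF: "G - F = G" using True by auto
      have wG: "w $ (insert b F, G - {b}) = (if a \<in> insert b F then
          - (ksign a (insert b F) * v $ (insert b F - {a}, insert a (G - {b}))) else 0)" if "b \<in> G" for b
      proof -
        have "insert b F \<union> (G - {b}) = F \<union> G" "insert b F \<inter> (G - {b}) = {}" using that True by auto
        then show ?thesis by (simp only: w a_def) simp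
      qed
      have kw: "kdiff \<Delta> w $ (F, G) = - (\<Sum>b\<in>G. ksign b F * w $ (insert b F, G - {b}))"
        using True by (simp add: kdiff_nth GF)
      show ?thesis
      proof (cases "a \<in> G")
        case aG: True
        then have "a \<notin> F" using True by auto
        then have "ksign b F * w $ (insert b F, G - {b}) = (if b = a then - (v $ (F, G)) else 0)" if "b \<in> G" for b
          using that aG by (auto simp: wG insert_absorb)
        then have "kdiff \<Delta> w $ (F, G) = - (\<Sum>b\<in>G. if b = a then - (v $ (F, G)) else 0)"
          unfolding kw by (simp cong: sum.cong)
        then show ?thesis using aG by simp
      next
        case aG: False
        define F0 where "F0 = F - {a}"
        have F0: "F = insert a F0" "a \<notin> F0" "F0 \<inter> G = {}" using aU aG True by (auto simp: F0_def)
        \<comment> \<open>Here |G| = d - i is at most k - 2, so one more element still gives a face,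
          and the cycle condition can be evaluated there.\<close>
        have "card (insert a G) < k" using aG True i by simp
        then have "insert a G \<in> \<Delta>" by (rule small)
        moreover have "insert a G - F0 = insert a G" using F0 by auto
        moreover have "kdiff \<Delta> v $ (F0, insert a G) = 0" using v by (simp add: kcycles_def)
        ultimately have "0 = (\<Sum>b\<in>insert a G. ksign b F0 * v $ (insert b F0, insert a G - {b}))"
          by (simp add: kdiff_nth)
        also have "\<dots> = ksign a F0 * v $ (F, G) + (\<Sum>b\<in>G. ksign b F0 * v $ (insert b F0, insert a G - {b}))"
          using aG F0 by simp
        finally have s: "(\<Sum>b\<in>G. ksign b F0 * v $ (insert b F0, insert a G - {b})) = - (ksign a F0 * v $ (F, G))"
          by (simp add: eq_neg_iff_add_eq_0 add.commute)
        have "ksign b F * w $ (insert b F, G - {b}) = ksign a F0 * (ksign b F0 * v $ (insert b F0, insert a G - {b}))"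
          if b: "b \<in> G" for b
        proof -
          have ab: "a \<noteq> b" "b \<notin> F0" using b aG F0 by auto
          then have *: "insert b F - {a} = insert b F0" "insert a (G - {b}) = insert a G - {b}" using F0 by auto
          have "w $ (insert b F, G - {b}) = - (ksign a (insert b F0) * v $ (insert b F0, insert a G - {b}))"
            unfolding wG[OF b] * by (simp add: F0(1) insert_commute[of b a])
          then have "ksign b F * w $ (insert b F, G - {b})
              = - (ksign b (insert a F0) * ksign a (insert b F0)) * v $ (insert b F0, insert a G - {b})"
            by (simp add: F0(1) algebra_simps)
          also have "ksign b (insert a F0) * ksign a (insert b F0) = - (ksign b F0 * ksign a F0 :: 'k)"
            using ab F0 by (intro ksign_swap') auto
          finally show ?thesis by (simp add: algebra_simps)
        qed
        then have "kdiff \<Delta> w $ (F, G) = - (ksign a F0 * (\<Sum>b\<in>G. ksign b F0 * v $ (insert b F0, insert a G - {b})))"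
          unfolding kw by (simp add: sum_distrib_left)
        then show ?thesis by (simp only: s mult_minus_right ksign_mult_self minus_minus)
      qed
    qed
    then have "v = kdiff \<Delta> w" by (simp add: vec_eq_iff)
    then show ?thesis using wch by (simp add: kbounds_def)
  qed
  then have "vec.dim (kcycles \<Delta> i d :: ('k ^ ('n set \<times> 'n set)) set) \<le> vec.dim (kbounds \<Delta> i d :: ('k ^ ('n set \<times> 'n set)) set)"
    by (intro vec.dim_subset) auto
  then show ?thesis by (simp add: koszul_betti_def)
qed

text \<open>Even for \<open>d = i + k\<close>, where the chains in degree \<open>i + 1\<close> differ, the boundaries agree: a basis element
  \<open>(F, G)\<close> with \<open>G \<notin> \<Delta>\<close> is mapped to a combination of pairs \<open>(F - a, G + a)\<close> with \<open>G + a \<notin> \<Delta>\<close>.\<close>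

lemma koszul_betti_truncation:
  fixes \<Delta> :: "'n::finite set set"
  assumes \<Delta>: "down_closed \<Delta>" and d: "i + k \<le> d"
  defines "\<Delta>' \<equiv> \<Delta> \<union> {A. card A < k}"
  shows "koszul_betti TYPE('k::field) \<Delta>' i d = koszul_betti TYPE('k) \<Delta> i d"
proof -
  have ch: "kchains \<Delta>' i d = (kchains \<Delta> i d :: ('k ^ ('n set \<times> 'n set)) set)"
  proof -
    have "{x \<in> kbasis \<Delta>' i. card (fst x) + card (snd x) = d} = {x \<in> kbasis \<Delta> i. card (fst x) + card (snd x) = d}"
      using d by (auto simp: kbasis_def \<Delta>'_def)
    then show ?thesis by (simp add: kchains_def)
  qed
  \<comment> \<open>The bound d + 1 admits both l = i and l = i + 1; the second case is needed for
    the boundaries.\<close>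
  have kd_eq: "kdiff \<Delta>' v = kdiff \<Delta> v" if v: "v \<in> kchains \<Delta>' l d" and l: "l + k \<le> d + 1"
    for v :: "'k ^ ('n set \<times> 'n set)" and l
  proof -
    have "kdiff \<Delta>' v $ (F, G) = kdiff \<Delta> v $ (F, G)" for F G
    proof (cases "G \<in> \<Delta>' - \<Delta>")
      case True
      have "v $ (insert a F, G - {a}) = 0" if a: "a \<in> G - F" for a
      proof -
        \<comment> \<open>An added face G has fewer than k elements, but a contributing chain needs
          |G - a| = d - l, which is at least k - 1.\<close>
        have "card (G - {a}) + 1 < k" using True a card_Suc_Diff1[of G a] by (auto simp: \<Delta>'_def)
        then have "\<not> (card (insert a F) = l \<and> card (insert a F) + card (G - {a}) = d)" using l by auto
        then show ?thesis using v by (auto simp: kchains_def supp_in_def kbasis_def)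
      qed
      then show ?thesis by (simp add: kdiff_nth)
    qed (auto simp: kdiff_nth \<Delta>'_def)
    then show ?thesis by (simp add: vec_eq_iff)
  qed
  have "kcycles \<Delta>' i d = (kcycles \<Delta> i d :: ('k ^ ('n set \<times> 'n set)) set)"
    using kd_eq[of _ i] d ch by (auto simp: kcycles_def)
  moreover have "kbounds \<Delta>' i d = (kbounds \<Delta> i d :: ('k ^ ('n set \<times> 'n set)) set)"
  proof (intro equalityI subsetI)
    fix u :: "'k ^ ('n set \<times> 'n set)" assume "u \<in> kbounds \<Delta>' i d"
    then obtain v where v: "v \<in> kchains \<Delta>' (Suc i) d" "u = kdiff \<Delta>' v" by (auto simp: kbounds_def)
    define v' where "v' = (\<chi> x. if snd x \<in> \<Delta> then v $ x else 0)"
    have "v' \<in> kchains \<Delta> (Suc i) d"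
      using v(1) by (auto simp: kchains_def supp_in_def kbasis_def v'_def)
    moreover have "kdiff \<Delta> v' $ (F, G) = kdiff \<Delta> v $ (F, G)" for F G
      using \<Delta> unfolding down_closed_def by (auto simp: kdiff_nth v'_def intro!: sum.cong)
    then have "u = kdiff \<Delta> v'" using v kd_eq[OF v(1)] d by (simp add: vec_eq_iff)
    ultimately show "u \<in> kbounds \<Delta> i d" by (simp add: kbounds_def)
  next
    fix u :: "'k ^ ('n set \<times> 'n set)" assume "u \<in> kbounds \<Delta> i d"
    then obtain v where v: "v \<in> kchains \<Delta> (Suc i) d" "u = kdiff \<Delta> v" by (auto simp: kbounds_def)
    have "v \<in> kchains \<Delta>' (Suc i) d"
      using v(1) by (auto simp: kchains_def supp_in_def kbasis_def \<Delta>'_def)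
    moreover from this have "u = kdiff \<Delta>' v" using v kd_eq[of v "Suc i"] d by simp
    ultimately show "u \<in> kbounds \<Delta>' i d" by (simp add: kbounds_def)
  qed
  ultimately show ?thesis by (simp add: koszul_betti_def)
qed

section \<open>Squarefree monomial ideals and their complexes\<close>

text \<open>A polynomial is the sum of its terms, and a squarefree generator divides a term as soon
  as its support is contained in that of the term.\<close>

lemma squarefree_ideal_gen:
  fixes S :: "('n::finite \<Rightarrow>\<^sub>0 nat) set"
  assumes "S \<subseteq> Collect squarefree_mon"
  defines "\<Delta> \<equiv> {A. \<forall>s\<in>S. \<not> Poly_Mapping.keys s \<subseteq> A}"
  shows "ideal_gen (monomial ` S) = (sr_ideal \<Delta> :: ('n, 'k::field) mpoly set)"
proof
  have "down_closed \<Delta>" by (auto simp: down_closed_def \<Delta>_def)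
  then have "module.subspace (*) (sr_ideal \<Delta> :: ('n, 'k) mpoly set)"
    using hom_ideal_sr_ideal by (auto simp: hom_ideal_def)
  then show "ideal_gen (monomial ` S) \<subseteq> (sr_ideal \<Delta> :: ('n, 'k) mpoly set)"
    unfolding ideal_gen_def
    by (intro module.span_minimal[OF module_times]) (auto simp: sr_ideal_def monomial_def \<Delta>_def)
next
  show "(sr_ideal \<Delta> :: ('n, 'k) mpoly set) \<subseteq> ideal_gen (monomial ` S)"
  proof
    fix f :: "('n, 'k) mpoly" assume f: "f \<in> sr_ideal \<Delta>"
    have "Poly_Mapping.single m (Poly_Mapping.lookup f m) \<in> ideal_gen (monomial ` S)"
      if m: "m \<in> Poly_Mapping.keys f" for m
    proof -
      obtain s where s: "s \<in> S" "Poly_Mapping.keys s \<subseteq> Poly_Mapping.keys m"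
        using f m by (auto simp: sr_ideal_def \<Delta>_def)
      then have "squarefree_mon s" using assms(1) by auto
      have "Poly_Mapping.lookup s x \<le> Poly_Mapping.lookup m x" for x
      proof (cases "x \<in> Poly_Mapping.keys s")
        case True
        then have "x \<in> Poly_Mapping.keys m" using s by blast
        then have "1 \<le> Poly_Mapping.lookup m x" by (simp add: in_keys_iff)
        moreover have "Poly_Mapping.lookup s x \<le> 1" using \<open>squarefree_mon s\<close> by (simp add: squarefree_mon_def)
        ultimately show ?thesis by simp
      qed (simp add: in_keys_iff)
      then have "m - s + s = m"
        by (intro poly_mapping_eqI) (simp add: lookup_add lookup_minus)
      then have "Poly_Mapping.single m (Poly_Mapping.lookup f m) =
          Poly_Mapping.single (m - s) (Poly_Mapping.lookup f m) * monomial s"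
        by (simp add: monomial_def mult_single)
      also have "\<dots> \<in> ideal_gen (monomial ` S)"
        unfolding ideal_gen_def using s
        by (intro module.span_scale[OF module_times] module.span_base[OF module_times]) auto
      finally show ?thesis .
    qed
    then have "(\<Sum>m\<in>Poly_Mapping.keys f. Poly_Mapping.single m (Poly_Mapping.lookup f m)) \<in> ideal_gen (monomial ` S)"
      unfolding ideal_gen_def by (rule module.span_sum[OF module_times])
    also have "(\<Sum>m\<in>Poly_Mapping.keys f. Poly_Mapping.single m (Poly_Mapping.lookup f m)) = f"
      by (rule poly_mapping_eqI) (auto simp: lookup_sum lookup_single when_def in_keys_iff)
    finally show "f \<in> ideal_gen (monomial ` S)" .
  qed
qed

lemma squarefree_monomial_ideal_sr_ideal:
  fixes I :: "('n::finite, 'k::field) mpoly set"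
  assumes "squarefree_monomial_ideal I"
  shows "\<exists>\<Delta>. down_closed \<Delta> \<and> I = sr_ideal \<Delta>"
proof -
  obtain S where "S \<subseteq> Collect squarefree_mon" "I = ideal_gen (monomial ` S)"
    using assms by (auto simp: squarefree_monomial_ideal_def)
  then show ?thesis
    by (intro exI[of _ "{A. \<forall>s\<in>S. \<not> Poly_Mapping.keys s \<subseteq> A}"]) (auto simp: squarefree_ideal_gen down_closed_def)
qed

lemma sqfree_power_sr_ideal:
  "(sqfree_power (int k) :: ('n::finite, 'k::field) mpoly set) = sr_ideal {A. card A < k}"
proof -
  let ?S = "{m :: 'n \<Rightarrow>\<^sub>0 nat. squarefree_mon m \<and> int (mdeg m) \<ge> int k}"
  have deg: "mdeg s = card (Poly_Mapping.keys s)" if "squarefree_mon s" for s :: "'n \<Rightarrow>\<^sub>0 nat"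
    using mdeg_sqf[of "Poly_Mapping.keys s"] sqf_keys[OF that] by simp
  have "{A. \<forall>s\<in>?S. \<not> Poly_Mapping.keys s \<subseteq> A} = {A. card A < k}"
  proof (intro equalityI subsetI)
    fix A assume A: "A \<in> {A. \<forall>s\<in>?S. \<not> Poly_Mapping.keys s \<subseteq> A}"
    \<comment> \<open>The product of the variables in A is itself squarefree of degree |A|, so it is
      the generator to test A against.\<close>
    then have "sqf A \<notin> ?S" by auto
    then show "A \<in> {A. card A < k}" by (simp add: squarefree_mon_sqf)
  next
    fix A :: "'n set" assume A: "A \<in> {A. card A < k}"
    have "\<not> Poly_Mapping.keys s \<subseteq> A" if "s \<in> ?S" for s
    proof
      assume "Poly_Mapping.keys s \<subseteq> A"
      then have "card (Poly_Mapping.keys s) \<le> card A" by (intro card_mono) simp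
      then show False using A that deg[of s] by simp
    qed
    then show "A \<in> {A. \<forall>s\<in>?S. \<not> Poly_Mapping.keys s \<subseteq> A}" by blast
  qed
  moreover have "?S \<subseteq> Collect squarefree_mon" by auto
  ultimately show ?thesis
    unfolding sqfree_power_def by (simp only: squarefree_ideal_gen)
qed

lemma sr_ideal_Int: "sr_ideal \<Delta> \<inter> sr_ideal \<Delta>' = sr_ideal (\<Delta> \<union> \<Delta>')"
  by (auto simp: sr_ideal_def)

lemma stanley_reisner_sr_ideal:
  "stanley_reisner (sr_ideal \<Delta> :: ('n::finite, 'k::field) mpoly set) = \<Delta>"
proof -
  have "stanley_reisner (sr_ideal \<Delta> :: ('n, 'k) mpoly set) =
      {Poly_Mapping.keys u |u. squarefree_mon u \<and> Poly_Mapping.keys u \<in> \<Delta>}"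
    by (simp add: stanley_reisner_def sr_ideal_def monomial_def)
  also have "\<dots> = \<Delta>"
  proof (intro equalityI subsetI)
    fix A assume "A \<in> \<Delta>"
    then have "A = Poly_Mapping.keys (sqf A) \<and> squarefree_mon (sqf A) \<and> Poly_Mapping.keys (sqf A) \<in> \<Delta>"
      by (simp add: squarefree_mon_sqf)
    then show "A \<in> {Poly_Mapping.keys u |u. squarefree_mon u \<and> Poly_Mapping.keys u \<in> \<Delta>}" by blast
  qed auto
  finally show ?thesis .
qed

section \<open>Signs and the four cases\<close>

lemma minus_one_powi: "(- 1 :: real) powi n = (if even n then 1 else - 1)"
  by (simp add: power_int_minus_left)

theorem theorem2p5:
  fixes I :: "('n::finite, 'k::field) mpoly set" and k :: int and i j :: nat
  assumes "squarefree_monomial_ideal I"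
    and "I \<noteq> {0}"
    and "k > int (Min {card (Poly_Mapping.keys u) |u. monomial u \<in> I})"
  shows "(i = 0 \<and> j = 0 \<longrightarrow> graded_betti (sqfree_truncation I k) i (int (i + j)) = 1) \<and>
         (i \<noteq> 0 \<and> int j \<le> k - 2 \<longrightarrow> graded_betti (sqfree_truncation I k) i (int (i + j)) = 0) \<and>
         (i \<noteq> 0 \<and> int j = k - 1 \<longrightarrow>
            real (graded_betti (sqfree_truncation I k) i (int (i + j))) = alpha I k i j) \<and>
         (i \<noteq> 0 \<and> int j \<ge> k \<longrightarrow>
            graded_betti (sqfree_truncation I k) i (int (i + j)) = graded_betti I i (int (i + j)))"
proof -
  obtain \<Delta> where \<Delta>: "down_closed \<Delta>" "I = sr_ideal \<Delta>"
    using squarefree_monomial_ideal_sr_ideal[OF assms(1)] by blast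
  obtain k' where k': "k = int k'" "k' > 0"
  proof
    \<comment> \<open>The minimum is a natural number, so k is positive; this makes the empty set a
      face of the enlarged complex.\<close>
    have "k > 0" using assms(3) by linarith
    then show "k = int (nat k)" "nat k > 0" by simp_all
  qed
  define \<Delta>' where "\<Delta>' = \<Delta> \<union> {A. card A < k'}"
  have dc: "down_closed \<Delta>'"
    unfolding down_closed_def \<Delta>'_def
  proof (intro ballI allI impI)
    fix A B :: "'n set" assume AB: "A \<in> \<Delta> \<union> {A. card A < k'}" "B \<subseteq> A"
    then show "B \<in> \<Delta> \<union> {A. card A < k'}"
      using \<Delta>(1) card_mono[of A B] by (auto simp: down_closed_def)
  qed
  have trunc: "sqfree_truncation I k = sr_ideal \<Delta>'"
    by (simp add: sqfree_truncation_def k' sqfree_power_sr_ideal \<Delta>(2) sr_ideal_Int \<Delta>'_def)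
  have small: "A \<in> \<Delta>'" if "card A < k'" for A using that by (simp add: \<Delta>'_def)
  let ?h = "\<lambda>l d. koszul_betti TYPE('k) \<Delta> l d" and ?h' = "\<lambda>l d. koszul_betti TYPE('k) \<Delta>' l d"
  have bI: "graded_betti I l (int d) = ?h l d" for l d
    unfolding \<Delta>(2) by (rule graded_betti_sr_ideal[OF \<Delta>(1)])
  have bT: "graded_betti (sqfree_truncation I k) l (int d) = ?h' l d" for l d
    unfolding trunc by (rule graded_betti_sr_ideal[OF dc])
  have vanish: "?h' l d = 0" if "l > 0" "d + 2 \<le> l + k'" for l d
    by (rule koszul_betti_vanish[OF dc small that])
  have same: "?h' l d = ?h l d" if "l + k' \<le> d" for l d
    unfolding \<Delta>'_def by (rule koszul_betti_truncation[OF \<Delta>(1) that])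
  have "real (?h' i (i + j)) = alpha I k i j" if i: "i \<noteq> 0" and j: "j + 1 = k'"
  proof -
    define d where "d = i + j"
    define E where "E = (\<Sum>r\<le>d. (- 1) ^ (d - r) * real (CARD('n) - r choose (d - r)) * real (num_faces \<Delta>' r))"
    have "E = (\<Sum>l\<le>d. (- 1) ^ l * real (?h' l d))"
      unfolding E_def by (rule koszul_betti_euler[OF dc, symmetric])
    \<comment> \<open>With d = i + k - 1 the terms with l > i fall into the vanishing range. Those
      with l < i are unchanged by the truncation, which leaves l = i as the only unknown.\<close>
    also have "\<dots> = (\<Sum>l\<in>insert i {..<i}. (- 1) ^ l * real (?h' l d))"
    proof (rule sum.mono_neutral_right)
      show "\<forall>l\<in>{..d} - insert i {..<i}. (- 1) ^ l * real (?h' l d) = 0"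
        using j vanish by (auto simp: d_def)
    qed (auto simp: d_def)
    also have "\<dots> = (- 1) ^ i * real (?h' i d) + (\<Sum>l<i. (- 1) ^ l * real (?h' l d))" by simp
    also have "(\<Sum>l<i. (- 1) ^ l * real (?h' l d)) = (\<Sum>l<i. (- 1) ^ l * real (?h l d))"
    proof (rule sum.cong[OF refl])
      fix l assume "l \<in> {..<i}"
      then have "l + k' \<le> d" using j by (simp add: d_def)
      then show "(- 1) ^ l * real (?h' l d) = (- 1) ^ l * real (?h l d)"
        by (simp add: same)
    qed
    finally have "(- 1) ^ i * E = (- 1) ^ i * ((- 1) ^ i * real (?h' i d)) + (- 1) ^ i * (\<Sum>l<i. (- 1) ^ l * real (?h l d))"
      by (simp add: distrib_left)
    then have main: "real (?h' i d) = (- 1) ^ i * E - (- 1) ^ i * (\<Sum>l<i. (- 1) ^ l * real (?h l d))"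
      by (simp flip: mult.assoc power_add)
    have A1: "(\<Sum>r = 0..d. (-1) powi (int j - int r) * real ((CARD('n) - r) choose (d - r)) * real (num_faces \<Delta>' r)) = (- 1) ^ i * E"
      unfolding E_def sum_distrib_left
    proof (rule sum.cong)
      fix r assume "r \<in> {..d}"
      \<comment> \<open>The two exponents differ by 2 i, since r \<le> d = i + j. The integer power
        also covers r > j.\<close>
      then have "even (int j - int r) \<longleftrightarrow> even (i + (d - r))"
        by (auto simp: d_def)
      then have "(-1) powi (int j - int r) = (- 1 :: real) ^ i * (- 1) ^ (d - r)"
        unfolding minus_one_powi power_add[symmetric] by simp
      then show "(-1) powi (int j - int r) * real ((CARD('n) - r) choose (d - r)) * real (num_faces \<Delta>' r) =
        (- 1) ^ i * ((- 1) ^ (d - r) * real (CARD('n) - r choose (d - r)) * real (num_faces \<Delta>' r))" by simp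
    qed auto
    have A2: "(\<Sum>(l, m)\<in>{(l, m). l + m = d \<and> l < i}. (-1) powi (int l - int i - 1) * real (graded_betti I l (int (l + m))))
      = - ((- 1) ^ i * (\<Sum>l<i. (- 1) ^ l * real (?h l d)))"
    proof -
      have "(\<Sum>(l, m)\<in>{(l, m). l + m = d \<and> l < i}. (-1) powi (int l - int i - 1) * real (graded_betti I l (int (l + m))))
        = (\<Sum>l<i. - ((- 1) ^ i * ((- 1) ^ l * real (?h l d))))"
      proof (rule sum.reindex_bij_witness[of _ "\<lambda>l. (l, d - l)" fst])
        fix x assume x: "x \<in> {(l, m). l + m = d \<and> l < i}"
        obtain l m where lm: "x = (l, m)" "l + m = d" using x by auto
        \<comment> \<open>The parity of l - i - 1 is opposite to that of i + l. This is the minus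
          sign that arises when the Euler characteristic is solved for l = i.\<close>
        have "(-1) powi (int l - int i - 1) = - ((- 1 :: real) ^ i * (- 1) ^ l)"
          unfolding minus_one_powi power_add[symmetric] by simp
        then show "- ((- 1) ^ i * ((- 1) ^ fst x * real (?h (fst x) d))) =
          (case x of (l, m) \<Rightarrow> (-1) powi (int l - int i - 1) * real (graded_betti I l (int (l + m))))"
          using bI[of l "l + m"] lm by (simp del: of_nat_add)
      qed (auto simp: d_def)
      then show ?thesis by (simp add: sum_negf sum_distrib_left)
    qed
    show ?thesis
      unfolding alpha_def trunc stanley_reisner_sr_ideal using main A1 A2 by (simp add: d_def)
  qed
  moreover have "?h' 0 0 = 1"
    using k' small[of "{}"] by (intro koszul_betti_0_0[OF dc]) simp
  moreover have "?h' i (i + j) = 0" if "i \<noteq> 0" "j + 2 \<le> k'"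
    using that by (simp add: vanish)
  moreover have "?h' i (i + j) = ?h i (i + j)" if "k' \<le> j"
    using that by (simp add: same)
  ultimately show ?thesis unfolding bT bI using k'(1) by auto
qed

end
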